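(* For every equivalence class $[\mathcal F]\in\beta\mathbb N/{=_\sim}$ which is not a singleton, at least one of the following conditions is satisfied: (1) there is $\mathcal P^u\in\mathcal B$ such that $\alpha_{\mathcal F}(\mathcal P^u)=\infty$; or (2) there is $\mathcal P^u\in\mathcal B$ of the second kind such that $\alpha_{\mathcal F}(\mathcal P^u)>0$.
   Context: Divisibility of ultrafilters. $\mathbb N=\{1,2,3,\dots\}$, $\mathbb P$ is the set of primes, $\beta\mathbb N$ is the set of ultrafilters on $\mathbb N$, with $n\in\mathbb N$ identified with the principal ultrafilter at $n$. For $A\subseteq\mathbb N$ let $A\uparrow=\{n\in\mathbb N:(\exists a\in A)\,a\mid n\}$, and $\mathcal U=\{A\subseteq\mathbb N: A\ne\emptyset,\ A=A\uparrow\}$. For $\mathcal F,\mathcal G\in\beta\mathbb N$: $\mathcal F\,\widetilde{\mid}\,\mathcal G$ iff $\mathcal F\cap\mathcal U\subseteq\mathcal G$; $\mathcal F=_\sim\mathcal G$ iff $\mathcal F\,\widetilde{\mid}\,\mathcal G$ and $\mathcal G\,\widetilde{\mid}\,\mathcal F$; $[\mathcal F]$ is the $=_\sim$-class of $\mathcal F$. Nonstandard extension. Standing assumption: we work in a fixed nonstandard extension ${}^*$ (of a superstructure over $\mathbb N$) which is $\mathfrak c^+$-saturated and satisfies Henson's isomorphism property (any two elementarily equivalent internally presented structures, for a finite first-order language, are isomorphic). In particular all sets $[1,z]=\{a\in{}^*\mathbb N:a\le z\}$ with $z\in{}^*\mathbb N\setminus\mathbb N$ have the same cardinality, denoted $\infty$.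 For $x\in{}^*\mathbb N$, $tp(x/\mathbb N)=\{A\subseteq\mathbb N:x\in{}^*A\}\in\beta\mathbb N$; $x\models\mathcal F$ ($x$ is a generator of $\mathcal F$) means $tp(x/\mathbb N)=\mathcal F$. Basic classes. $\overline{\mathbb P}=\{\mathcal P\in\beta\mathbb N:\mathbb P\in\mathcal P\}$. For $\mathcal P\in\overline{\mathbb P}$, on pairs $(p,a)$ with $p\models\mathcal P$, $a\in{}^*\mathbb N$, put $(p,a)\approx_{\mathcal P}(q,b)$ iff $tp(p^a/\mathbb N)=_\sim tp(q^b/\mathbb N)$; $\mathcal E_{\mathcal P}$ is the set of $\approx_{\mathcal P}$-classes. For $u\in\mathcal E_{\mathcal P}$ the set $\mathcal P^u=\{tp(p^a/\mathbb N):(p,a)\in u\}$ is called a basic class, and $\mathcal B$ is the set of all basic classes (for all $\mathcal P\in\overline{\mathbb P}$ and $u\in\mathcal E_{\mathcal P}$). $p^a\models\mathcal P^u$ means that $p^a$ is a generator of some ultrafilter in $\mathcal P^u$. Kinds. If $\mathcal P\in\overline{\mathbb P}\setminus\mathbb P$ (i.e. $\mathcal P$ is a nonprincipal prime ultrafilter), one distinguishes the basic classes $\mathcal P^u$ of the first kind, those such that, for every $p\models\mathcal P$, the set $u_p=\{a\in{}^*\mathbb N:p^a\models\mathcal P^u\}$ is a singleton, and those of the second kind, such that, for every $p\models\mathcal P$, $u_p$ is a union of consecutive galaxies (blocks of order type $(\mathbb Z,<)$ in ${}^*\mathbb N$). Patterns. $\mathbb N_\infty=\{0,1,2,\dots\}\cup\{\infty\}$.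 For $x\in{}^*\mathbb N$, $p\in{}^*\mathbb P$, $a\in{}^*\mathbb N$, $p^a\,{}^*\!\!\parallel x$ means $x=p^ax'$ with $p$ not dividing $x'$ (in the sense of the extended divisibility relation on ${}^*\mathbb N$). The pattern of $x$ is $\alpha_x:\mathcal B\to\mathbb N_\infty$, $\alpha_x(\mathcal P^u)=|\{(p,a):p^a\models\mathcal P^u,\ p^a\,{}^*\!\!\parallel x\}|$ (this cardinality is known to lie in $\mathbb N_\infty$). For $\mathcal F\in\beta\mathbb N$, $\alpha_{\mathcal F}:=\alpha_x$ for any $x\models\mathcal F$ (known to be independent of $x$).
   Formalization: "Second kind" is also applied to basic classes over principal primes (those of p^a, p a standard prime, a infinite); with kinds only for nonprincipal P the claim fails for the type of 2^a with a infinite. *)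

theory Defs
  imports
    Main
    "HOL-Library.Equipollence"
    "HOL-Library.Extended_Nat"
    "HOL-Computational_Algebra.Primes"
begin

section \<open>Divisibility of ultrafilters\<close>

definition Npos :: "nat set" where
  "Npos = {0<..}"

definition primes :: "nat set" where
  "primes = {p. prime p}"

definition ultrafilter_on :: "'a set \<Rightarrow> 'a set set \<Rightarrow> bool" where
  "ultrafilter_on X F \<longleftrightarrow>
     F \<subseteq> Pow X \<and> X \<in> F \<and> {} \<notin> F \<and>
     (\<forall>A\<in>F. \<forall>B\<in>F. A \<inter> B \<in> F) \<and>
     (\<forall>A\<in>F. \<forall>B. A \<subseteq> B \<and> B \<subseteq> X \<longrightarrow> B \<in> F) \<and>
     (\<forall>A. A \<subseteq> X \<longrightarrow> A \<in> F \<or> X - A \<in> F)"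

definition betaN :: "nat set set set" where
  "betaN = {F. ultrafilter_on Npos F}"

definition up :: "nat set \<Rightarrow> nat set" where
  "up A = {n \<in> Npos. \<exists>a\<in>A. a dvd n}"

definition upsets :: "nat set set" where
  "upsets = {A. A \<subseteq> Npos \<and> A \<noteq> {} \<and> A = up A}"

definition uf_dvd :: "nat set set \<Rightarrow> nat set set \<Rightarrow> bool" where
  "uf_dvd F G \<longleftrightarrow> F \<inter> upsets \<subseteq> G"

definition uf_equiv :: "nat set set \<Rightarrow> nat set set \<Rightarrow> bool" where
  "uf_equiv F G \<longleftrightarrow> uf_dvd F G \<and> uf_dvd G F"

definition uf_class :: "nat set set \<Rightarrow> nat set set set" where
  "uf_class F = {G \<in> betaN. uf_equiv F G}"

definition prime_ultrafilters :: "nat set set set" where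
  "prime_ultrafilters = {P \<in> betaN. primes \<in> P}"


section \<open>Superstructures\<close>

record 'u set_structure =
  elem :: "'u \<Rightarrow> 'u \<Rightarrow> bool"
  atoms :: "'u set"

primrec level :: "'u set_structure \<Rightarrow> nat \<Rightarrow> 'u set" where
  "level V 0 = atoms V"
| "level V (Suc n) = level V n \<union> {s. s \<notin> atoms V \<and> (\<forall>y. elem V y s \<longrightarrow> y \<in> level V n)}"

text \<open>
  The structure is, up to isomorphism, the superstructure over its set \<open>X\<close> of atoms: the union of
  the levels \<open>V\<^sub>0 = X\<close>, \<open>V\<^sub>n\<^sub>+\<^sub>1 = V\<^sub>n \<union> Pow V\<^sub>n\<close>. Atoms have no elements and differ from the empty set.
\<close>

definition superstructure :: "'u set_structure \<Rightarrow> bool" where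
  "superstructure V \<longleftrightarrow>
     (\<forall>x\<in>atoms V. \<forall>y. \<not> elem V y x) \<and>
     (\<forall>s t. s \<notin> atoms V \<and> t \<notin> atoms V \<and> (\<forall>y. elem V y s \<longleftrightarrow> elem V y t) \<longrightarrow> s = t) \<and>
     (\<forall>n. \<forall>A. A \<subseteq> level V n \<longrightarrow> (\<exists>s. s \<notin> atoms V \<and> (\<forall>y. elem V y s \<longleftrightarrow> y \<in> A))) \<and>
     (\<forall>x. \<exists>n. x \<in> level V n)"

definition elts :: "'u set_structure \<Rightarrow> 'u \<Rightarrow> 'u set" where
  "elts V s = {y. elem V y s}"

definition mkset :: "'u set_structure \<Rightarrow> 'u set \<Rightarrow> 'u" where
  "mkset V A = (THE s. s \<notin> atoms V \<and> elts V s = A)"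

definition kpair :: "'u set_structure \<Rightarrow> 'u \<Rightarrow> 'u \<Rightarrow> 'u" where
  "kpair V x y = mkset V {mkset V {x}, mkset V {x, y}}"

fun tuple :: "'u set_structure \<Rightarrow> 'u list \<Rightarrow> 'u" where
  "tuple V [] = mkset V {}"
| "tuple V [x] = x"
| "tuple V (x # y # zs) = kpair V x (tuple V (y # zs))"


section \<open>Nonstandard extensions\<close>

text \<open>Bounded formulas of the language of set theory; \<open>BAll i j \<phi>\<close> is \<open>\<forall>x\<^sub>i \<in> x\<^sub>j. \<phi>\<close>.\<close>

datatype bfm = BEq nat nat | BMem nat nat | BNeg bfm | BAnd bfm bfm | BAll nat nat bfm

primrec bsat :: "'u set_structure \<Rightarrow> (nat \<Rightarrow> 'u) \<Rightarrow> bfm \<Rightarrow> bool" where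
  "bsat V e (BEq i j) \<longleftrightarrow> e i = e j"
| "bsat V e (BMem i j) \<longleftrightarrow> elem V (e i) (e j)"
| "bsat V e (BNeg \<phi>) \<longleftrightarrow> \<not> bsat V e \<phi>"
| "bsat V e (BAnd \<phi> \<psi>) \<longleftrightarrow> bsat V e \<phi> \<and> bsat V e \<psi>"
| "bsat V e (BAll i j \<phi>) \<longleftrightarrow> (\<forall>y. elem V y (e j) \<longrightarrow> bsat V (e(i := y)) \<phi>)"

text \<open>
  \<open>standard\<close> is the superstructure over the positive integers (\<open>num n\<close> being the atom that stands
  for \<open>n\<close>), \<open>nonstandard\<close> is the superstructure over the set of hypernaturals, and \<open>star\<close> maps the
  former into the latter.
\<close>

record ('v, 'w) extension =
  standard :: "'v set_structure"
  nonstandard :: "'w set_structure"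
  num :: "nat \<Rightarrow> 'v"
  star :: "'v \<Rightarrow> 'w"

definition starset :: "('v, 'w) extension \<Rightarrow> nat set \<Rightarrow> 'w set" where
  "starset S A = elts (nonstandard S) (star S (mkset (standard S) (num S ` A)))"

abbreviation hypernat :: "('v, 'w) extension \<Rightarrow> 'w set" where
  "hypernat S \<equiv> starset S Npos"

definition std :: "('v, 'w) extension \<Rightarrow> nat \<Rightarrow> 'w" where
  "std S n = star S (num S n)"

definition infinite_hypernat :: "('v, 'w) extension \<Rightarrow> 'w set" where
  "infinite_hypernat S = hypernat S - std S ` Npos"

definition nonstandard_extension :: "('v, 'w) extension \<Rightarrow> bool" where
  "nonstandard_extension S \<longleftrightarrow>
     superstructure (standard S) \<and> superstructure (nonstandard S) \<and>
     inj_on (num S) Npos \<and> atoms (standard S) = num S ` Npos \<and>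
     atoms (nonstandard S) = hypernat S \<and>
     infinite_hypernat S \<noteq> {} \<and>
     (\<forall>\<phi> e. bsat (standard S) e \<phi> \<longleftrightarrow> bsat (nonstandard S) (star S \<circ> e) \<phi>)"

definition internal_set :: "('v, 'w) extension \<Rightarrow> 'w \<Rightarrow> bool" where
  "internal_set S s \<longleftrightarrow>
     s \<notin> atoms (nonstandard S) \<and> (\<exists>A. elem (nonstandard S) s (star S A))"

definition c_plus_saturated :: "('v, 'w) extension \<Rightarrow> bool" where
  "c_plus_saturated S \<longleftrightarrow>
     (\<forall>\<C>. (\<forall>s\<in>\<C>. internal_set S s) \<and> \<C> \<lesssim> (UNIV :: nat set set) \<and>
          (\<forall>\<D>. \<D> \<subseteq> \<C> \<and> finite \<D> \<and> \<D> \<noteq> {} \<longrightarrow> (\<Inter>s\<in>\<D>. elts (nonstandard S) s) \<noteq> {})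
        \<longrightarrow> (\<Inter>s\<in>\<C>. elts (nonstandard S) s) \<noteq> {})"


section \<open>The isomorphism property\<close>

text \<open>
  A finite first-order language consists of the lists of the arities of its function symbols
  (constants have arity 0) and of its relation symbols.
\<close>

type_synonym language = "nat list \<times> nat list"

datatype fotm = Var nat | Fn nat "fotm list"

datatype fofm = FEq fotm fotm | FRel nat "fotm list" | FNeg fofm | FAnd fofm fofm | FAll nat fofm

fun wf_tm :: "language \<Rightarrow> fotm \<Rightarrow> bool" where
  "wf_tm L (Var i) \<longleftrightarrow> True"
| "wf_tm L (Fn f ts) \<longleftrightarrow>
     f < length (fst L) \<and> length ts = fst L ! f \<and> (\<forall>t\<in>set ts. wf_tm L t)"

fun wf_fm :: "language \<Rightarrow> fofm \<Rightarrow> bool" where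
  "wf_fm L (FEq s t) \<longleftrightarrow> wf_tm L s \<and> wf_tm L t"
| "wf_fm L (FRel r ts) \<longleftrightarrow>
     r < length (snd L) \<and> length ts = snd L ! r \<and> (\<forall>t\<in>set ts. wf_tm L t)"
| "wf_fm L (FNeg \<phi>) \<longleftrightarrow> wf_fm L \<phi>"
| "wf_fm L (FAnd \<phi> \<psi>) \<longleftrightarrow> wf_fm L \<phi> \<and> wf_fm L \<psi>"
| "wf_fm L (FAll i \<phi>) \<longleftrightarrow> wf_fm L \<phi>"

fun fv_tm :: "fotm \<Rightarrow> nat set" where
  "fv_tm (Var i) = {i}"
| "fv_tm (Fn f ts) = (\<Union>t\<in>set ts. fv_tm t)"

fun fv_fm :: "fofm \<Rightarrow> nat set" where
  "fv_fm (FEq s t) = fv_tm s \<union> fv_tm t"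
| "fv_fm (FRel r ts) = (\<Union>t\<in>set ts. fv_tm t)"
| "fv_fm (FNeg \<phi>) = fv_fm \<phi>"
| "fv_fm (FAnd \<phi> \<psi>) = fv_fm \<phi> \<union> fv_fm \<psi>"
| "fv_fm (FAll i \<phi>) = fv_fm \<phi> - {i}"

record 'u fo_structure =
  univ :: "'u set"
  funs :: "nat \<Rightarrow> 'u list \<Rightarrow> 'u"
  rels :: "nat \<Rightarrow> 'u list \<Rightarrow> bool"

definition args :: "'u fo_structure \<Rightarrow> nat \<Rightarrow> 'u list set" where
  "args M k = {xs. set xs \<subseteq> univ M \<and> length xs = k}"

definition is_structure :: "language \<Rightarrow> 'u fo_structure \<Rightarrow> bool" where
  "is_structure L M \<longleftrightarrow>
     univ M \<noteq> {} \<and> (\<forall>f < length (fst L). \<forall>xs \<in> args M (fst L ! f). funs M f xs \<in> univ M)"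

fun val :: "'u fo_structure \<Rightarrow> (nat \<Rightarrow> 'u) \<Rightarrow> fotm \<Rightarrow> 'u" where
  "val M e (Var i) = e i"
| "val M e (Fn f ts) = funs M f (map (val M e) ts)"

fun sat :: "'u fo_structure \<Rightarrow> (nat \<Rightarrow> 'u) \<Rightarrow> fofm \<Rightarrow> bool" where
  "sat M e (FEq s t) \<longleftrightarrow> val M e s = val M e t"
| "sat M e (FRel r ts) \<longleftrightarrow> rels M r (map (val M e) ts)"
| "sat M e (FNeg \<phi>) \<longleftrightarrow> \<not> sat M e \<phi>"
| "sat M e (FAnd \<phi> \<psi>) \<longleftrightarrow> sat M e \<phi> \<and> sat M e \<psi>"
| "sat M e (FAll i \<phi>) \<longleftrightarrow> (\<forall>x\<in>univ M. sat M (e(i := x)) \<phi>)"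

definition holds :: "'u fo_structure \<Rightarrow> fofm \<Rightarrow> bool" where
  "holds M \<phi> \<longleftrightarrow> (\<forall>e. range e \<subseteq> univ M \<longrightarrow> sat M e \<phi>)"

definition elementarily_equivalent :: "language \<Rightarrow> 'u fo_structure \<Rightarrow> 'u fo_structure \<Rightarrow> bool" where
  "elementarily_equivalent L M N \<longleftrightarrow>
     (\<forall>\<phi>. wf_fm L \<phi> \<and> fv_fm \<phi> = {} \<longrightarrow> (holds M \<phi> \<longleftrightarrow> holds N \<phi>))"

definition isomorphic :: "language \<Rightarrow> 'u fo_structure \<Rightarrow> 'u fo_structure \<Rightarrow> bool" where
  "isomorphic L M N \<longleftrightarrow>
     (\<exists>h. bij_betw h (univ M) (univ N) \<and>
        (\<forall>f < length (fst L). \<forall>xs \<in> args M (fst L ! f). h (funs M f xs) = funs N f (map h xs)) \<and>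
        (\<forall>r < length (snd L). \<forall>xs \<in> args M (snd L ! r). rels M r xs \<longleftrightarrow> rels N r (map h xs)))"

text \<open>The domain, the graphs of the functions and the relations are internal sets.\<close>

definition internally_presented ::
    "('v, 'w) extension \<Rightarrow> language \<Rightarrow> 'w fo_structure \<Rightarrow> bool" where
  "internally_presented S L M \<longleftrightarrow>
     is_structure L M \<and>
     (\<exists>d. internal_set S d \<and> elts (nonstandard S) d = univ M) \<and>
     (\<forall>f < length (fst L). \<exists>g. internal_set S g \<and>
        elts (nonstandard S) g =
          {tuple (nonstandard S) (xs @ [funs M f xs]) | xs. xs \<in> args M (fst L ! f)}) \<and>
     (\<forall>r < length (snd L). \<exists>g. internal_set S g \<and>
        elts (nonstandard S) g =
          {tuple (nonstandard S) xs | xs. xs \<in> args M (snd L ! r) \<and> rels M r xs})"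

definition isomorphism_property :: "('v, 'w) extension \<Rightarrow> bool" where
  "isomorphism_property S \<longleftrightarrow>
     (\<forall>L M N. internally_presented S L M \<and> internally_presented S L N \<and>
        elementarily_equivalent L M N \<longrightarrow> isomorphic L M N)"


section \<open>Arithmetic of the hypernaturals\<close>

definition starrel :: "('v, 'w) extension \<Rightarrow> nat list set \<Rightarrow> 'w list \<Rightarrow> bool" where
  "starrel S R xs \<longleftrightarrow>
     elem (nonstandard S) (tuple (nonstandard S) xs)
       (star S (mkset (standard S) ((\<lambda>ns. tuple (standard S) (map (num S) ns)) ` R)))"

definition starop :: "('v, 'w) extension \<Rightarrow> (nat \<Rightarrow> nat \<Rightarrow> nat) \<Rightarrow> 'w \<Rightarrow> 'w \<Rightarrow> 'w" where
  "starop S f x y =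
     (THE z. z \<in> hypernat S \<and> starrel S {[m, n, f m n] | m n. m \<in> Npos \<and> n \<in> Npos} [x, y, z])"

definition hadd :: "('v, 'w) extension \<Rightarrow> 'w \<Rightarrow> 'w \<Rightarrow> 'w" where
  "hadd S = starop S (\<lambda>m n. m + n)"

definition hmult :: "('v, 'w) extension \<Rightarrow> 'w \<Rightarrow> 'w \<Rightarrow> 'w" where
  "hmult S = starop S (\<lambda>m n. m * n)"

definition hpow :: "('v, 'w) extension \<Rightarrow> 'w \<Rightarrow> 'w \<Rightarrow> 'w" where
  "hpow S = starop S (\<lambda>m n. m ^ n)"

definition hle :: "('v, 'w) extension \<Rightarrow> 'w \<Rightarrow> 'w \<Rightarrow> bool" where
  "hle S x y \<longleftrightarrow> starrel S {[m, n] | m n. m \<in> Npos \<and> n \<in> Npos \<and> m \<le> n} [x, y]"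

definition hdvd :: "('v, 'w) extension \<Rightarrow> 'w \<Rightarrow> 'w \<Rightarrow> bool" where
  "hdvd S x y \<longleftrightarrow> starrel S {[m, n] | m n. m \<in> Npos \<and> n \<in> Npos \<and> m dvd n} [x, y]"

definition initial_segment :: "('v, 'w) extension \<Rightarrow> 'w \<Rightarrow> 'w set" where
  "initial_segment S z = {a \<in> hypernat S. hle S a z}"

definition galaxy :: "('v, 'w) extension \<Rightarrow> 'w \<Rightarrow> 'w set" where
  "galaxy S a = {b \<in> hypernat S.
     b = a \<or> (\<exists>n\<in>Npos. b = hadd S a (std S n) \<or> a = hadd S b (std S n))}"

text \<open>Only the galaxies of infinite elements have order type \<open>(\<int>, <)\<close>.\<close>

definition union_of_consecutive_galaxies :: "('v, 'w) extension \<Rightarrow> 'w set \<Rightarrow> bool" where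
  "union_of_consecutive_galaxies S U \<longleftrightarrow>
     (\<exists>\<G>. \<G> \<noteq> {} \<and> \<G> \<subseteq> galaxy S ` infinite_hypernat S \<and> U = \<Union>\<G> \<and>
        (\<forall>a\<in>U. \<forall>b\<in>U. \<forall>c\<in>hypernat S. hle S a c \<and> hle S c b \<longrightarrow> galaxy S c \<in> \<G>))"


section \<open>Basic classes and patterns\<close>

definition tp :: "('v, 'w) extension \<Rightarrow> 'w \<Rightarrow> nat set set" where
  "tp S x = {A. A \<subseteq> Npos \<and> x \<in> starset S A}"

definition generators :: "('v, 'w) extension \<Rightarrow> nat set set \<Rightarrow> 'w set" where
  "generators S F = {x \<in> hypernat S. tp S x = F}"

definition power_equiv ::
    "('v, 'w) extension \<Rightarrow> nat set set \<Rightarrow> (('w \<times> 'w) \<times> ('w \<times> 'w)) set" where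
  "power_equiv S P =
     {((p, a), (q, b)). p \<in> generators S P \<and> q \<in> generators S P \<and>
        a \<in> hypernat S \<and> b \<in> hypernat S \<and>
        uf_equiv (tp S (hpow S p a)) (tp S (hpow S q b))}"

definition exponent_classes :: "('v, 'w) extension \<Rightarrow> nat set set \<Rightarrow> ('w \<times> 'w) set set" where
  "exponent_classes S P = (generators S P \<times> hypernat S) // power_equiv S P"

definition basic_class :: "('v, 'w) extension \<Rightarrow> ('w \<times> 'w) set \<Rightarrow> nat set set set" where
  "basic_class S u = {tp S (hpow S p a) | p a. (p, a) \<in> u}"

definition basic_classes :: "('v, 'w) extension \<Rightarrow> nat set set set set" where
  "basic_classes S = {basic_class S u | P u. P \<in> prime_ultrafilters \<and> u \<in> exponent_classes S P}"

text \<open>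
  The prime ultrafilter \<open>P\<close> may be principal. For a prime number \<open>p\<close>, the exponents of the basic
  class consisting of the types of all \<open>p\<^sup>a\<close> with \<open>a\<close> infinite form the union of all galaxies, so
  that this class is of the second kind.
\<close>

definition second_kind :: "('v, 'w) extension \<Rightarrow> nat set set set \<Rightarrow> bool" where
  "second_kind S C \<longleftrightarrow>
     (\<exists>P\<in>prime_ultrafilters. \<exists>u\<in>exponent_classes S P. C = basic_class S u \<and>
        (\<forall>p\<in>generators S P.
           union_of_consecutive_galaxies S {a \<in> hypernat S. tp S (hpow S p a) \<in> C}))"

definition exactly_divides :: "('v, 'w) extension \<Rightarrow> 'w \<Rightarrow> 'w \<Rightarrow> 'w \<Rightarrow> bool" where
  "exactly_divides S p a x \<longleftrightarrow>
     (\<exists>x'\<in>hypernat S. x = hmult S (hpow S p a) x' \<and> \<not> hdvd S p x')"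

text \<open>
  \<open>T\<close> has cardinality \<open>k\<close>, where the element \<open>\<infinity>\<close> of \<open>enat\<close> stands for the common cardinality of
  the sets \<open>[1, z]\<close> with \<open>z\<close> infinite.
\<close>

definition has_size :: "('v, 'w) extension \<Rightarrow> 'b set \<Rightarrow> enat \<Rightarrow> bool" where
  "has_size S T k \<longleftrightarrow>
     (case k of enat n \<Rightarrow> finite T \<and> card T = n
      | \<infinity> \<Rightarrow> (\<forall>z\<in>infinite_hypernat S. T \<approx> initial_segment S z))"

definition pattern_at :: "('v, 'w) extension \<Rightarrow> 'w \<Rightarrow> nat set set set \<Rightarrow> enat" where
  "pattern_at S x C =
     (THE k. has_size S
        {(p, a). p \<in> starset S primes \<and> a \<in> hypernat S \<and>
           tp S (hpow S p a) \<in> C \<and> exactly_divides S p a x} k)"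

text \<open>The pattern at a generator of \<open>F\<close> does not depend on the generator.\<close>

definition pattern :: "('v, 'w) extension \<Rightarrow> nat set set \<Rightarrow> nat set set set \<Rightarrow> enat" where
  "pattern S F = pattern_at S (SOME x. x \<in> generators S F)"

end

theory Submission
  imports Defs
begin

text \<open>
  If \<open>F\<close> contains an antichain \<open>A\<close> for divisibility, then \<open>[F]\<close> is a singleton: every \<open>B \<in> F\<close> with
  \<open>B \<subseteq> A\<close> is the difference of two upward closed sets. So let \<open>x\<close> be a generator of an \<open>F\<close> without
  antichains, and consider the components of \<open>x\<close>, that is, the prime powers \<open>p\<^sup>a\<close> exactly dividing \<open>x\<close>.

  If there are infinitely many of them, saturation yields a component \<open>y\<close> such that infinitely many
  components lie in each set of the type of \<open>y\<close>, and then a divisor of \<open>x\<close> with an infinite number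
  of components, all of the type of \<open>y\<close>. The basic class of \<open>y\<close> occurs \<open>\<infinity>\<close> times in \<open>x\<close>.

  If there are finitely many of them and the type of each contains an antichain, then finitely many
  antichains of prime powers contain all components of \<open>x\<close>; among the numbers with boundedly many
  components, all from these antichains, divisibility chains are of bounded length, and hence \<open>F\<close>
  contains an antichain. So there is a component \<open>p\<^sup>a\<close> whose type contains no antichain. If \<open>p\<^sup>b\<close>
  and \<open>p\<^sup>b\<^sup>+\<^sup>1\<close> are not equivalent, then the type of each of them contains an antichain; hence the basic
  class of \<open>p\<^sup>a\<close> is of the second kind.
\<close>

section \<open>Pairs in superstructures\<close>

text \<open>Divisibility classes see only upward closed sets; an antichain is what lets differences
  of such sets recover a whole ultrafilter, so antichains govern every case. The three hypotheses on
  \<open>S\<close> enter separately. Transfer is given for bounded formulas of set theory, so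
  arithmetic with arbitrary predicates on the naturals is coded into these once, and later facts
  about hypernaturals are single transferred formulas. Saturation asks for at most continuum many
  internal sets; sections of standard binary relations at one hypernatural parameter meet this
  bound. The isomorphism property is applied to structures for the empty language: all [1, z] with
  infinite z become equipotent, so that a set squeezed between two of them has size \<infinity>. The
  obstacle is that components of x are counted internally by a hypernatural, while the pattern
  counts externally: a finite external count has to become a standard bound before it says anything
  about \<open>F\<close>, and infinitely many components have to yield an infinite hypernatural
  number of components of one exact type.\<close>

lemma level_mono: "m \<le> n \<Longrightarrow> level V m \<subseteq> level V n"
  by (induction n) (auto simp: le_Suc_eq)

lemma elem_not_atom: "superstructure V \<Longrightarrow> elem V y s \<Longrightarrow> s \<notin> atoms V"
  unfolding superstructure_def by (elim conjE) metis

lemma set_extensionality: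
  "superstructure V \<Longrightarrow> s \<notin> atoms V \<Longrightarrow> t \<notin> atoms V \<Longrightarrow> (\<And>y. elem V y s \<longleftrightarrow> elem V y t) \<Longrightarrow> s = t"
  unfolding superstructure_def by (elim conjE) metis

lemma ex_level: "superstructure V \<Longrightarrow> \<exists>n. x \<in> level V n"
  unfolding superstructure_def by (elim conjE) metis

lemma finite_subset_level:
  assumes "superstructure V" "finite A"
  shows "\<exists>n. A \<subseteq> level V n"
  using assms(2)
proof (induction A)
  case (insert x A)
  then obtain n where "A \<subseteq> level V n" by blast
  moreover obtain m where "x \<in> level V m" using ex_level[OF assms(1)] by blast
  ultimately show ?case
    using level_mono[of m "max m n" V] level_mono[of n "max m n" V] by (intro exI[of _ "max m n"]) auto
qed simp

text \<open>Comprehension in a superstructure is granted for subsets of a single level;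
  extensionality among non-atoms then makes the description operator in \<open>mkset\<close> well
  defined.\<close>

lemma mkset_level:
  assumes V: "superstructure V" and A: "A \<subseteq> level V n"
  shows "mkset V A \<notin> atoms V \<and> elts V (mkset V A) = A"
proof -
  obtain s where s: "s \<notin> atoms V" "\<And>y. elem V y s \<longleftrightarrow> y \<in> A"
    using V A unfolding superstructure_def by metis
  show ?thesis
    unfolding mkset_def
  proof (rule theI)
    show "s \<notin> atoms V \<and> elts V s = A" using s by (auto simp: elts_def)
    fix t assume "t \<notin> atoms V \<and> elts V t = A"
    then have "t \<notin> atoms V" "\<And>y. elem V y s \<longleftrightarrow> elem V y t" using s by (auto simp: elts_def)
    then show "t = s" using set_extensionality[OF V s(1)] by simp
  qed
qed

lemma elem_mkset_level:
  "superstructure V \<Longrightarrow> A \<subseteq> level V n \<Longrightarrow> elem V y (mkset V A) \<longleftrightarrow> y \<in> A"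
  using mkset_level[of V A n] by (auto simp: elts_def)

lemma mkset_in_level:
  assumes "superstructure V" "A \<subseteq> level V n"
  shows "mkset V A \<in> level V (Suc n)"
  using mkset_level[OF assms] assms(2) by (auto simp: elts_def)

lemma kpair_in_level:
  assumes V: "superstructure V" and "x \<in> level V n" "y \<in> level V n"
  shows "kpair V x y \<in> level V (Suc (Suc n))"
proof -
  have "mkset V {x} \<in> level V (Suc n)" "mkset V {x, y} \<in> level V (Suc n)"
    using assms by (auto intro!: mkset_in_level simp del: level.simps)
  then show ?thesis unfolding kpair_def by (intro mkset_in_level[OF V]) (simp del: level.simps)
qed

lemma elem_mkset_finite:
  "superstructure V \<Longrightarrow> finite A \<Longrightarrow> elem V y (mkset V A) \<longleftrightarrow> y \<in> A"
  using finite_subset_level elem_mkset_level by metis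

text \<open>Nonemptiness of \<open>A\<close> rules out atoms, which have no elements either and
  would pass for the empty set.\<close>

lemma eq_mkset_iff:
  assumes V: "superstructure V" and A: "finite A" "A \<noteq> {}"
  shows "t = mkset V A \<longleftrightarrow> (\<forall>y. elem V y t \<longleftrightarrow> y \<in> A)"
proof
  assume *: "\<forall>y. elem V y t \<longleftrightarrow> y \<in> A"
  then have "t \<notin> atoms V" using A(2) elem_not_atom[OF V] by blast
  moreover have "mkset V A \<notin> atoms V"
    using finite_subset_level[OF V A(1)] mkset_level[OF V] by blast
  ultimately show "t = mkset V A"
    using set_extensionality[OF V] * elem_mkset_finite[OF V A(1)] by presburger
qed (use elem_mkset_finite[OF V A(1)] in simp)

text \<open>All quantifiers on the right are bounded by \<open>t\<close> or by an element of
  \<open>t\<close>: this makes being a pair expressible by a bounded formula.\<close>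

lemma eq_kpair_iff:
  assumes V: "superstructure V"
  shows "t = kpair V x y \<longleftrightarrow>
    (\<exists>u. elem V u t \<and> (\<exists>v. elem V v t \<and> (\<forall>s. elem V s t \<longrightarrow> s = u \<or> s = v) \<and>
      (elem V x u \<and> (\<forall>s. elem V s u \<longrightarrow> s = x)) \<and>
      (elem V x v \<and> elem V y v \<and> (\<forall>s. elem V s v \<longrightarrow> s = x \<or> s = y))))"
    (is "_ \<longleftrightarrow> ?R")
proof -
  have u: "u = mkset V {x} \<longleftrightarrow> elem V x u \<and> (\<forall>s. elem V s u \<longrightarrow> s = x)" for u
    using eq_mkset_iff[OF V, of "{x}" u] by auto
  have v: "v = mkset V {x, y} \<longleftrightarrow> elem V x v \<and> elem V y v \<and> (\<forall>s. elem V s v \<longrightarrow> s = x \<or> s = y)" for v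
    using eq_mkset_iff[OF V, of "{x, y}" v] by auto
  have "?R \<longleftrightarrow> elem V (mkset V {x}) t \<and> elem V (mkset V {x, y}) t \<and>
      (\<forall>s. elem V s t \<longrightarrow> s = mkset V {x} \<or> s = mkset V {x, y})"
    unfolding u[symmetric] v[symmetric] by blast
  also have "\<dots> \<longleftrightarrow> t = kpair V x y"
    unfolding kpair_def using eq_mkset_iff[OF V, of "{mkset V {x}, mkset V {x, y}}" t] by auto
  finally show ?thesis by blast
qed

lemma kpair_eq_iff:
  assumes V: "superstructure V"
  shows "kpair V x y = kpair V x' y' \<longleftrightarrow> x = x' \<and> y = y'"
proof
  have e: "elem V s (kpair V a b) \<longleftrightarrow> s = mkset V {a} \<or> s = mkset V {a, b}" for s a b
    unfolding kpair_def using elem_mkset_finite[OF V] by simp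
  have i: "mkset V A = mkset V B \<longleftrightarrow> A = B" if "finite A" "finite B" for A B
    using that elem_mkset_finite[OF V] by (metis Set.set_eqI)
  assume *: "kpair V x y = kpair V x' y'"
  have m: "s = mkset V {x} \<or> s = mkset V {x, y} \<longleftrightarrow> s = mkset V {x'} \<or> s = mkset V {x', y'}" for s
    using e[of s x y] e[of s x' y'] * by simp
  have "{x} = {x'} \<or> {x} = {x', y'}" using m[of "mkset V {x}"] by (simp only: i finite.intros simp_thms)
  moreover have "{x, y} = {x'} \<or> {x, y} = {x', y'}"
    using m[of "mkset V {x, y}"] by (simp only: i finite.intros simp_thms)
  moreover have "{x', y'} = {x} \<or> {x', y'} = {x, y}"
    using m[of "mkset V {x', y'}"] by (simp only: i finite.intros simp_thms)
  ultimately show "x = x' \<and> y = y'" by (auto simp: doubleton_eq_iff)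
qed simp

section \<open>Bounded formulas about pairs\<close>

definition BOr :: "bfm \<Rightarrow> bfm \<Rightarrow> bfm" where "BOr a b = BNeg (BAnd (BNeg a) (BNeg b))"
definition BEx :: "nat \<Rightarrow> nat \<Rightarrow> bfm \<Rightarrow> bfm" where "BEx i j a = BNeg (BAll i j (BNeg a))"

lemma bsat_BOr [simp]: "bsat V e (BOr a b) \<longleftrightarrow> bsat V e a \<or> bsat V e b"
  by (simp add: BOr_def)

lemma bsat_BEx [simp]: "bsat V e (BEx i j a) \<longleftrightarrow> (\<exists>y. elem V y (e j) \<and> bsat V (e(i := y)) a)"
  by (simp add: BEx_def)

text \<open>Syntactic copy of \<open>eq_kpair_iff\<close>. The scratch variables \<open>u\<close>
  and \<open>v\<close> hold the singleton and the doubleton inside the pair, \<open>s\<close> runs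
  through elements.\<close>

definition BPair :: "nat \<Rightarrow> nat \<Rightarrow> nat \<Rightarrow> nat \<Rightarrow> nat \<Rightarrow> nat \<Rightarrow> bfm" where
  "BPair u v s t x y =
     BEx u t (BEx v t (BAnd (BAll s t (BOr (BEq s u) (BEq s v)))
       (BAnd (BAnd (BMem x u) (BAll s u (BEq s x)))
         (BAnd (BMem x v) (BAnd (BMem y v) (BAll s v (BOr (BEq s x) (BEq s y))))))))"

lemma bsat_BPair:
  assumes "superstructure V" "distinct [u, v, s]" "{u, v, s} \<inter> {t, x, y} = {}"
  shows "bsat V e (BPair u v s t x y) \<longleftrightarrow> e t = kpair V (e x) (e y)"
proof -
  have neq: "u \<noteq> t" "u \<noteq> x" "u \<noteq> y" "v \<noteq> t" "v \<noteq> x" "v \<noteq> y" "s \<noteq> t" "s \<noteq> x" "s \<noteq> y" "u \<noteq> v" "u \<noteq> s" "v \<noteq> s"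
    using assms by auto
  show ?thesis
    unfolding eq_kpair_iff[OF assms(1), of "e t"] BPair_def
    by (simp only: bsat.simps bsat_BOr bsat_BEx fun_upd_apply if_True if_False neq neq[symmetric] simp_thms)
qed

section \<open>Transfer for arithmetical formulas\<close>

text \<open>Atomic symbols are arbitrary HOL predicates on the naturals, so notions such as
  \<open>components\<close> need no definition inside set theory. There are no function terms;
  operations appear through their graphs or inside predicates.\<close>

datatype nfm =
    R1 "nat \<Rightarrow> bool" nat
  | R2 "nat \<Rightarrow> nat \<Rightarrow> bool" nat nat
  | R3 "nat \<Rightarrow> nat \<Rightarrow> nat \<Rightarrow> bool" nat nat nat
  | NEq nat nat | NNeg nfm | NAnd nfm nfm | NOr nfm nfm | NImp nfm nfm | NAll nat nfm | NEx nat nfm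

primrec nsat :: "(nat \<Rightarrow> nat) \<Rightarrow> nfm \<Rightarrow> bool" where
  "nsat e (R1 P i) \<longleftrightarrow> P (e i)"
| "nsat e (R2 P i j) \<longleftrightarrow> P (e i) (e j)"
| "nsat e (R3 P i j k) \<longleftrightarrow> P (e i) (e j) (e k)"
| "nsat e (NEq i j) \<longleftrightarrow> e i = e j"
| "nsat e (NNeg a) \<longleftrightarrow> \<not> nsat e a"
| "nsat e (NAnd a b) \<longleftrightarrow> nsat e a \<and> nsat e b"
| "nsat e (NOr a b) \<longleftrightarrow> nsat e a \<or> nsat e b"
| "nsat e (NImp a b) \<longleftrightarrow> (nsat e a \<longrightarrow> nsat e b)"
| "nsat e (NAll i a) \<longleftrightarrow> (\<forall>n>0. nsat (e(i := n)) a)"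
| "nsat e (NEx i a) \<longleftrightarrow> (\<exists>n>0. nsat (e(i := n)) a)"

definition rel1 :: "(nat \<Rightarrow> bool) \<Rightarrow> nat list set" where
  "rel1 P = {[m] | m. m \<in> Npos \<and> P m}"
definition rel2 :: "(nat \<Rightarrow> nat \<Rightarrow> bool) \<Rightarrow> nat list set" where
  "rel2 P = {[m, n] | m n. m \<in> Npos \<and> n \<in> Npos \<and> P m n}"
definition rel3 :: "(nat \<Rightarrow> nat \<Rightarrow> nat \<Rightarrow> bool) \<Rightarrow> nat list set" where
  "rel3 P = {[m, n, k] | m n k. m \<in> Npos \<and> n \<in> Npos \<and> k \<in> Npos \<and> P m n k}"

lemma Bex_rel2: "(\<exists>x\<in>rel2 P. Q x) \<longleftrightarrow> (\<exists>m\<in>Npos. \<exists>n\<in>Npos. P m n \<and> Q [m, n])"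
  by (auto simp: rel2_def)

lemma Bex_rel3:
  "(\<exists>x\<in>rel3 P. Q x) \<longleftrightarrow> (\<exists>m\<in>Npos. \<exists>n\<in>Npos. \<exists>k\<in>Npos. P m n k \<and> Q [m, n, k])"
  by (auto simp: rel3_def)

text \<open>The common form of the two readings of a formula, over the standard and over the
  nonstandard superstructure: \<open>N\<close> is the set of numbers, and \<open>c\<close> assigns
  to a relation the object that represents it.\<close>

primrec gsat :: "'u set_structure \<Rightarrow> 'u \<Rightarrow> (nat list set \<Rightarrow> 'u) \<Rightarrow> (nat \<Rightarrow> 'u) \<Rightarrow> nfm \<Rightarrow> bool" where
  "gsat V N c e (R1 P i) \<longleftrightarrow> elem V (tuple V [e i]) (c (rel1 P))"
| "gsat V N c e (R2 P i j) \<longleftrightarrow> elem V (tuple V [e i, e j]) (c (rel2 P))"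
| "gsat V N c e (R3 P i j k) \<longleftrightarrow> elem V (tuple V [e i, e j, e k]) (c (rel3 P))"
| "gsat V N c e (NEq i j) \<longleftrightarrow> e i = e j"
| "gsat V N c e (NNeg a) \<longleftrightarrow> \<not> gsat V N c e a"
| "gsat V N c e (NAnd a b) \<longleftrightarrow> gsat V N c e a \<and> gsat V N c e b"
| "gsat V N c e (NOr a b) \<longleftrightarrow> gsat V N c e a \<or> gsat V N c e b"
| "gsat V N c e (NImp a b) \<longleftrightarrow> (gsat V N c e a \<longrightarrow> gsat V N c e b)"
| "gsat V N c e (NAll i a) \<longleftrightarrow> (\<forall>y. elem V y N \<longrightarrow> gsat V N c (e(i := y)) a)"
| "gsat V N c e (NEx i a) \<longleftrightarrow> (\<exists>y. elem V y N \<and> gsat V N c (e(i := y)) a)"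

text \<open>In order of occurrence and with repetitions, so that a translated subformula finds its
  relations at consecutive variables \<open>rpar k\<close>, \<open>rpar (k + 1)\<close>, and so
  on.\<close>

primrec params :: "nfm \<Rightarrow> nat list set list" where
  "params (R1 P i) = [rel1 P]"
| "params (R2 P i j) = [rel2 P]"
| "params (R3 P i j k) = [rel3 P]"
| "params (NEq i j) = []"
| "params (NNeg a) = params a"
| "params (NAnd a b) = params a @ params b"
| "params (NOr a b) = params a @ params b"
| "params (NImp a b) = params a @ params b"
| "params (NAll i a) = params a"
| "params (NEx i a) = params a"

text \<open>
  In the translation to bounded formulas, the variables \<open>3 i\<close> stand for the variables of the
  arithmetical formula, the variables \<open>3 j + 1\<close> for its relations, the variable 2 for the set of
  positive integers; the other variables are auxiliary.
\<close>

definition rvar :: "nat \<Rightarrow> nat" where "rvar i = 3 * i"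
definition rpar :: "nat \<Rightarrow> nat" where "rpar i = 3 * i + 1"
definition raux :: "nat \<Rightarrow> nat" where "raux i = 3 * i + 2"

lemma rvar_simps [simp]:
  "rvar i = rvar j \<longleftrightarrow> i = j" "rpar i = rpar j \<longleftrightarrow> i = j" "raux i = raux j \<longleftrightarrow> i = j"
  "rvar i \<noteq> rpar j" "rvar i \<noteq> raux j" "rpar i \<noteq> raux j"
  "rpar i \<noteq> rvar j" "raux i \<noteq> rvar j" "raux i \<noteq> rpar j"
  unfolding rvar_def rpar_def raux_def by presburger+

primrec bfm_of :: "nat \<Rightarrow> nfm \<Rightarrow> bfm" where
  "bfm_of k (R1 P i) = BMem (rvar i) (rpar k)"
| "bfm_of k (R2 P i j) =
     BEx (raux 1) (rpar k) (BPair (raux 2) (raux 3) (raux 4) (raux 1) (rvar i) (rvar j))"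
| "bfm_of k (R3 P i j l) =
     BEx (raux 1) (rpar k) (BEx (raux 5) (raux 1) (BEx (raux 6) (raux 5)
       (BAnd (BPair (raux 2) (raux 3) (raux 4) (raux 1) (rvar i) (raux 6))
         (BPair (raux 2) (raux 3) (raux 4) (raux 6) (rvar j) (rvar l)))))"
| "bfm_of k (NEq i j) = BEq (rvar i) (rvar j)"
| "bfm_of k (NNeg a) = BNeg (bfm_of k a)"
| "bfm_of k (NAnd a b) = BAnd (bfm_of k a) (bfm_of (k + length (params a)) b)"
| "bfm_of k (NOr a b) = BOr (bfm_of k a) (bfm_of (k + length (params a)) b)"
| "bfm_of k (NImp a b) = BOr (BNeg (bfm_of k a)) (bfm_of (k + length (params a)) b)"
| "bfm_of k (NAll i a) = BAll (rvar i) (raux 0) (bfm_of k a)"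
| "bfm_of k (NEx i a) = BEx (rvar i) (raux 0) (bfm_of k a)"

text \<open>A triple is a pair whose second entry is again a pair. That entry is an element of an
  element of the triple, so two nested bounded quantifiers reach it in the clause for
  \<open>R3\<close>.\<close>

lemma kpair_snd_elem:
  assumes "superstructure V"
  shows "\<exists>v. elem V v (kpair V x y) \<and> elem V y v"
  using elem_mkset_finite[OF assms]
  by (intro exI[of _ "mkset V {x, y}"]) (simp add: kpair_def)

text \<open>\<open>k\<close> varies in the induction because the second operand of a connective
  reads its relations after those of the first.\<close>

lemma bsat_bfm_of:
  assumes V: "superstructure V"
  shows "E (raux 0) = N \<Longrightarrow> (\<And>j. j < length (params a) \<Longrightarrow> E (rpar (k + j)) = c (params a ! j)) \<Longrightarrow>
    bsat V E (bfm_of k a) \<longleftrightarrow> gsat V N c (\<lambda>i. E (rvar i)) a"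
proof (induction a arbitrary: E k)
  case (R2 P i j)
  then show ?case using bsat_BPair[OF V] by auto
next
  case (R3 P i j l)
  then show ?case using bsat_BPair[OF V] kpair_snd_elem[OF V] by auto
next
  case (NAnd a b)
  have "E (rpar (k + j)) = c (params a ! j)" if "j < length (params a)" for j
    using NAnd.prems(2)[of j] that by (simp add: nth_append)
  moreover have "E (rpar (k + length (params a) + j)) = c (params b ! j)" if "j < length (params b)" for j
    using NAnd.prems(2)[of "length (params a) + j"] that by (simp add: nth_append add.assoc)
  ultimately show ?case
    using NAnd.IH(1)[of E k] NAnd.IH(2)[of E "k + length (params a)"] NAnd.prems(1) by simp
next
  case (NOr a b)
  have "E (rpar (k + j)) = c (params a ! j)" if "j < length (params a)" for j
    using NOr.prems(2)[of j] that by (simp add: nth_append)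
  moreover have "E (rpar (k + length (params a) + j)) = c (params b ! j)" if "j < length (params b)" for j
    using NOr.prems(2)[of "length (params a) + j"] that by (simp add: nth_append add.assoc)
  ultimately show ?case
    using NOr.IH(1)[of E k] NOr.IH(2)[of E "k + length (params a)"] NOr.prems(1) by simp
next
  case (NImp a b)
  have "E (rpar (k + j)) = c (params a ! j)" if "j < length (params a)" for j
    using NImp.prems(2)[of j] that by (simp add: nth_append)
  moreover have "E (rpar (k + length (params a) + j)) = c (params b ! j)" if "j < length (params b)" for j
    using NImp.prems(2)[of "length (params a) + j"] that by (simp add: nth_append add.assoc)
  ultimately show ?case
    using NImp.IH(1)[of E k] NImp.IH(2)[of E "k + length (params a)"] NImp.prems(1) by simp
next
  case (NAll i a)
  have "bsat V (E(rvar i := y)) (bfm_of k a) \<longleftrightarrow> gsat V N c ((\<lambda>i. E (rvar i))(i := y)) a" for y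
  proof -
    have "(\<lambda>j. (E(rvar i := y)) (rvar j)) = (\<lambda>i. E (rvar i))(i := y)" by auto
    then show ?thesis
      using NAll.IH[of "E(rvar i := y)" k] NAll.prems by (simp del: fun_upd_apply) (simp add: fun_upd_def)
  qed
  then show ?case using NAll.prems by simp
next
  case (NEx i a)
  have "bsat V (E(rvar i := y)) (bfm_of k a) \<longleftrightarrow> gsat V N c ((\<lambda>i. E (rvar i))(i := y)) a" for y
  proof -
    have "(\<lambda>j. (E(rvar i := y)) (rvar j)) = (\<lambda>i. E (rvar i))(i := y)" by auto
    then show ?thesis
      using NEx.IH[of "E(rvar i := y)" k] NEx.prems by (simp del: fun_upd_apply) (simp add: fun_upd_def)
  qed
  then show ?case using NEx.prems by simp
qed auto

section \<open>Arithmetical truth in the hypernaturals\<close>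

definition star1 :: "('v, 'w) extension \<Rightarrow> (nat \<Rightarrow> bool) \<Rightarrow> 'w \<Rightarrow> bool" where
  "star1 S P x \<longleftrightarrow> x \<in> starset S {n \<in> Npos. P n}"
definition star2 :: "('v, 'w) extension \<Rightarrow> (nat \<Rightarrow> nat \<Rightarrow> bool) \<Rightarrow> 'w \<Rightarrow> 'w \<Rightarrow> bool" where
  "star2 S P x y \<longleftrightarrow> starrel S (rel2 P) [x, y]"
definition star3 :: "('v, 'w) extension \<Rightarrow> (nat \<Rightarrow> nat \<Rightarrow> nat \<Rightarrow> bool) \<Rightarrow> 'w \<Rightarrow> 'w \<Rightarrow> 'w \<Rightarrow> bool" where
  "star3 S P x y z \<longleftrightarrow> starrel S (rel3 P) [x, y, z]"

primrec hsat :: "('v, 'w) extension \<Rightarrow> (nat \<Rightarrow> 'w) \<Rightarrow> nfm \<Rightarrow> bool" where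
  "hsat S e (R1 P i) \<longleftrightarrow> star1 S P (e i)"
| "hsat S e (R2 P i j) \<longleftrightarrow> star2 S P (e i) (e j)"
| "hsat S e (R3 P i j k) \<longleftrightarrow> star3 S P (e i) (e j) (e k)"
| "hsat S e (NEq i j) \<longleftrightarrow> e i = e j"
| "hsat S e (NNeg a) \<longleftrightarrow> \<not> hsat S e a"
| "hsat S e (NAnd a b) \<longleftrightarrow> hsat S e a \<and> hsat S e b"
| "hsat S e (NOr a b) \<longleftrightarrow> hsat S e a \<or> hsat S e b"
| "hsat S e (NImp a b) \<longleftrightarrow> (hsat S e a \<longrightarrow> hsat S e b)"
| "hsat S e (NAll i a) \<longleftrightarrow> (\<forall>x\<in>hypernat S. hsat S (e(i := x)) a)"
| "hsat S e (NEx i a) \<longleftrightarrow> (\<exists>x\<in>hypernat S. hsat S (e(i := x)) a)"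

definition stdrel :: "('v, 'w) extension \<Rightarrow> nat list set \<Rightarrow> 'v" where
  "stdrel S R = mkset (standard S) ((\<lambda>ns. tuple (standard S) (map (num S) ns)) ` R)"

lemma starrel_stdrel:
  "starrel S R xs \<longleftrightarrow> elem (nonstandard S) (tuple (nonstandard S) xs) (star S (stdrel S R))"
  by (simp add: starrel_def stdrel_def)

locale hyperextension =
  fixes S :: "('v, 'w) extension"
  assumes ext: "nonstandard_extension S"
begin

lemma std_super: "superstructure (standard S)" and nonstd_super: "superstructure (nonstandard S)"
  and num_inj: "inj_on (num S) Npos" and std_atoms: "atoms (standard S) = num S ` Npos"
  and nonstd_atoms: "atoms (nonstandard S) = hypernat S"
  and infinite_hypernat_nonempty: "infinite_hypernat S \<noteq> {}"
  and bounded_transfer: "bsat (standard S) e \<phi> \<longleftrightarrow> bsat (nonstandard S) (star S \<circ> e) \<phi>"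
  using ext unfolding nonstandard_extension_def by blast+

lemma atoms_level0: "n \<in> Npos \<Longrightarrow> num S n \<in> level (standard S) 0"
  by (simp add: std_atoms)

lemma elem_std_mkset:
  assumes "A \<subseteq> Npos" "n \<in> Npos"
  shows "elem (standard S) (num S n) (mkset (standard S) (num S ` A)) \<longleftrightarrow> n \<in> A"
proof -
  have "num S ` A \<subseteq> level (standard S) 0" using assms(1) atoms_level0 by blast
  from elem_mkset_level[OF std_super this] show ?thesis
    using num_inj assms by (auto simp: inj_on_def)
qed

lemma elem_std_Npos: "elem (standard S) y (mkset (standard S) (num S ` Npos)) \<longleftrightarrow> (\<exists>n\<in>Npos. y = num S n)"
  using elem_mkset_level[OF std_super, of "num S ` Npos" 0] atoms_level0 by auto

text \<open>A Kuratowski pair lies two levels above its entries: pairs of atoms reach level 2 and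
  triples, as nested pairs, level 4.\<close>

lemma stdrel_level:
  assumes "R = rel1 P1 \<or> R = rel2 P2 \<or> R = rel3 P3"
  shows "(\<lambda>ns. tuple (standard S) (map (num S) ns)) ` R \<subseteq> level (standard S) 4"
proof -
  note k = kpair_in_level[OF std_super]
  have 0: "num S n \<in> level (standard S) 0" "num S n \<in> level (standard S) 2" "num S n \<in> level (standard S) 4"
    if "n \<in> Npos" for n
    using atoms_level0[OF that] level_mono[of 0 2 "standard S"] level_mono[of 0 4 "standard S"]
    by (auto simp del: level.simps)
  have 2: "kpair (standard S) (num S m) (num S n) \<in> level (standard S) 2" if "m \<in> Npos" "n \<in> Npos" for m n
    using k[OF 0(1) 0(1), OF that] by (simp add: eval_nat_numeral del: level.simps)
  have 3: "kpair (standard S) (num S l) (kpair (standard S) (num S m) (num S n)) \<in> level (standard S) 4"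
    if "l \<in> Npos" "m \<in> Npos" "n \<in> Npos" for l m n
    using k[OF 0(2) 2, OF that] by (simp add: eval_nat_numeral del: level.simps)
  have "level (standard S) 2 \<subseteq> level (standard S) 4" by (rule level_mono) simp
  then show ?thesis using assms 0 2 3
    by (elim disjE) (auto simp: rel1_def rel2_def rel3_def simp del: level.simps)
qed

lemma stdrel_rel1: "stdrel S (rel1 P) = mkset (standard S) (num S ` {n \<in> Npos. P n})"
  unfolding stdrel_def rel1_def by (rule arg_cong[of _ _ "mkset _"]) force

lemma nsat_gsat:
  assumes "\<And>i. e i > 0"
  shows "nsat e a \<longleftrightarrow> gsat (standard S) (mkset (standard S) (num S ` Npos)) (stdrel S) (num S \<circ> e) a"
  using assms
proof (induction a arbitrary: e)
  case (R1 P i)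
  show ?case
    using elem_std_mkset[OF Collect_restrict, of "e i" P] R1 by (simp add: stdrel_rel1 Npos_def)
next
  case (R2 P i j)
  have n: "num S a = num S b \<longleftrightarrow> a = b" if "a > 0" "b > 0" for a b
    using num_inj that by (auto simp: inj_on_def Npos_def)
  show ?case
    using elem_mkset_level[OF std_super stdrel_level[of "rel2 P" _ P]] n R2
    by (auto simp: stdrel_def image_iff Bex_rel2 Npos_def kpair_eq_iff[OF std_super])
next
  case (R3 P i j k)
  have n: "num S a = num S b \<longleftrightarrow> a = b" if "a > 0" "b > 0" for a b
    using num_inj that by (auto simp: inj_on_def Npos_def)
  show ?case
    using elem_mkset_level[OF std_super stdrel_level[of "rel3 P" _ _ P]] n R3
    by (auto simp: stdrel_def image_iff Bex_rel3 Npos_def kpair_eq_iff[OF std_super])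
next
  case (NEq i j)
  then show ?case using num_inj by (auto simp: inj_on_def Npos_def)
next
  case (NAll i a)
  have "nsat (e(i := n)) a \<longleftrightarrow> gsat (standard S) (mkset (standard S) (num S ` Npos)) (stdrel S) ((num S \<circ> e)(i := num S n)) a"
    if "n > 0" for n
  proof -
    have "\<And>j. (e(i := n)) j > 0" using NAll.prems that by simp
    moreover have "num S \<circ> e(i := n) = (num S \<circ> e)(i := num S n)" by auto
    ultimately show ?thesis using NAll.IH[of "e(i := n)"] by (simp only:)
  qed
  then show ?case unfolding nsat.simps gsat.simps elem_std_Npos by (auto simp: Npos_def)
next
  case (NEx i a)
  have "nsat (e(i := n)) a \<longleftrightarrow> gsat (standard S) (mkset (standard S) (num S ` Npos)) (stdrel S) ((num S \<circ> e)(i := num S n)) a"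
    if "n > 0" for n
  proof -
    have "\<And>j. (e(i := n)) j > 0" using NEx.prems that by simp
    moreover have "num S \<circ> e(i := n) = (num S \<circ> e)(i := num S n)" by auto
    ultimately show ?thesis using NEx.IH[of "e(i := n)"] by (simp only:)
  qed
  then show ?case unfolding nsat.simps gsat.simps elem_std_Npos by (auto simp: Npos_def)
qed auto

lemma hsat_gsat:
  "hsat S e a \<longleftrightarrow> gsat (nonstandard S) (star S (mkset (standard S) (num S ` Npos))) (star S \<circ> stdrel S) e a"
  by (induction a arbitrary: e)
    (simp_all add: star1_def star2_def star3_def starrel_stdrel starset_def elts_def stdrel_rel1 Ball_def Bex_def)

text \<open>Bounded transfer is the middle link of the chain: before it, arithmetic is coded in the
  standard superstructure; after it, the code is read off in the nonstandard one.\<close>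

theorem transfer:
  assumes "\<And>i. e i > 0"
  shows "nsat e a \<longleftrightarrow> hsat S (std S \<circ> e) a"
proof -
  define N where "N = mkset (standard S) (num S ` Npos)"
  \<comment> \<open>One assignment has to carry the variables, the relations and the set of numbers
    through bounded transfer together.\<close>
  define E where "E n = (if n mod 3 = 0 then num S (e (n div 3)) else
    if n mod 3 = 1 then stdrel S (params a ! (n div 3)) else N)" for n
  have E: "E (rvar i) = num S (e i)" "E (rpar i) = stdrel S (params a ! i)" "E (raux i) = N" for i
  proof -
    have "3 * i mod 3 = 0" "3 * i div 3 = i" "(3 * i + 1) mod 3 = 1" "(3 * i + 1) div 3 = i" "(3 * i + 2) mod 3 = 2"
      by presburger+
    then show "E (rvar i) = num S (e i)" "E (rpar i) = stdrel S (params a ! i)" "E (raux i) = N"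
      unfolding E_def rvar_def rpar_def raux_def by simp_all
  qed
  have "nsat e a \<longleftrightarrow> gsat (standard S) N (stdrel S) (num S \<circ> e) a"
    using nsat_gsat[OF assms] by (simp add: N_def)
  also have "\<dots> \<longleftrightarrow> bsat (standard S) E (bfm_of 0 a)"
    using bsat_bfm_of[OF std_super, of E N a 0 "stdrel S"] by (simp add: E comp_def)
  also have "\<dots> \<longleftrightarrow> bsat (nonstandard S) (star S \<circ> E) (bfm_of 0 a)"
    by (rule bounded_transfer)
  also have "\<dots> \<longleftrightarrow> gsat (nonstandard S) (star S N) (star S \<circ> stdrel S) (std S \<circ> e) a"
    using bsat_bfm_of[OF nonstd_super, of "star S \<circ> E" "star S N" a 0 "star S \<circ> stdrel S"]
    by (simp add: E comp_def std_def)
  also have "\<dots> \<longleftrightarrow> hsat S (std S \<circ> e) a"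
    by (simp add: hsat_gsat N_def)
  finally show ?thesis .
qed

end

section \<open>Ultrafilters, types and saturation\<close>

lemma betaN_axioms:
  assumes "F \<in> betaN"
  shows "F \<subseteq> Pow Npos" "Npos \<in> F" "{} \<notin> F" "\<forall>A\<in>F. \<forall>B\<in>F. A \<inter> B \<in> F"
    "\<forall>A\<in>F. \<forall>B. A \<subseteq> B \<and> B \<subseteq> Npos \<longrightarrow> B \<in> F"
    "\<forall>A. A \<subseteq> Npos \<longrightarrow> A \<in> F \<or> Npos - A \<in> F"
proof -
  note * = assms[unfolded betaN_def ultrafilter_on_def mem_Collect_eq]
  show "F \<subseteq> Pow Npos" using * by (elim conjE)
  show "Npos \<in> F" using * by (elim conjE)
  show "{} \<notin> F" using * by (elim conjE)
  show "\<forall>A\<in>F. \<forall>B\<in>F. A \<inter> B \<in> F" using * by (elim conjE)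
  show "\<forall>A\<in>F. \<forall>B. A \<subseteq> B \<and> B \<subseteq> Npos \<longrightarrow> B \<in> F" using * by (elim conjE)
  show "\<forall>A. A \<subseteq> Npos \<longrightarrow> A \<in> F \<or> Npos - A \<in> F" using * by (elim conjE)
qed

lemma betaN_subset: "F \<in> betaN \<Longrightarrow> A \<in> F \<Longrightarrow> A \<subseteq> Npos"
  using betaN_axioms(1) by blast

lemma betaN_top: "F \<in> betaN \<Longrightarrow> Npos \<in> F"
  by (rule betaN_axioms(2))

lemma betaN_empty: "F \<in> betaN \<Longrightarrow> {} \<notin> F"
  by (rule betaN_axioms(3))

lemma betaN_Int: "F \<in> betaN \<Longrightarrow> A \<in> F \<Longrightarrow> B \<in> F \<Longrightarrow> A \<inter> B \<in> F"
  using betaN_axioms(4) by blast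

lemma betaN_mono: "F \<in> betaN \<Longrightarrow> A \<in> F \<Longrightarrow> A \<subseteq> B \<Longrightarrow> B \<subseteq> Npos \<Longrightarrow> B \<in> F"
  using betaN_axioms(5) by blast

lemma betaN_compl: "F \<in> betaN \<Longrightarrow> A \<subseteq> Npos \<Longrightarrow> A \<notin> F \<Longrightarrow> Npos - A \<in> F"
  using betaN_axioms(6) by blast

lemma betaN_compl_iff:
  assumes "F \<in> betaN" "A \<subseteq> Npos"
  shows "Npos - A \<in> F \<longleftrightarrow> A \<notin> F"
proof
  assume "Npos - A \<in> F"
  moreover have "A \<inter> (Npos - A) = {}" by blast
  ultimately show "A \<notin> F"
    using betaN_Int[OF assms(1), of A "Npos - A"] betaN_empty[OF assms(1)] by auto
qed (rule betaN_compl[OF assms])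

lemma betaN_eqI:
  assumes F: "F \<in> betaN" and G: "G \<in> betaN" and "F \<subseteq> G"
  shows "F = G"
proof
  show "G \<subseteq> F"
  proof
    fix A assume A: "A \<in> G"
    then have "A \<subseteq> Npos" using betaN_subset[OF G] by simp
    then show "A \<in> F" using A assms(3) betaN_compl_iff[OF F] betaN_compl_iff[OF G] by blast
  qed
qed (fact assms(3))

section \<open>Internal sections and transfer with parameters\<close>

definition NIff :: "nfm \<Rightarrow> nfm \<Rightarrow> nfm" where
  "NIff a b = NAnd (NImp a b) (NImp b a)"

lemma nsat_NIff [simp]: "nsat e (NIff a b) \<longleftrightarrow> (nsat e a \<longleftrightarrow> nsat e b)"
  by (auto simp: NIff_def)

lemma hsat_NIff [simp]: "hsat S e (NIff a b) \<longleftrightarrow> (hsat S e a \<longleftrightarrow> hsat S e b)"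
  by (auto simp: NIff_def)

context hyperextension begin

lemma hypernat_eq: "hypernat S = elts (nonstandard S) (star S (mkset (standard S) (num S ` Npos)))"
  by (simp add: starset_def)

text \<open>In the standard superstructure each section \<open>{n. P m n}\<close> belongs to the set
  \<open>W\<close> of all subsets of the positive integers. Bounding the quantifier over sections by
  \<open>W\<close> makes the statement transferable and puts the section at a hypernatural
  \<open>x\<close> into \<open>star S W\<close>, so it is internal.\<close>

lemma internal_section:
  assumes x: "x \<in> hypernat S"
  shows "\<exists>s. internal_set S s \<and> elts (nonstandard S) s = {y \<in> hypernat S. star2 S P x y}"
proof -
  define N where "N = mkset (standard S) (num S ` Npos)"
  define pow where "pow = (\<lambda>A. mkset (standard S) (num S ` A)) ` Pow Npos"
  define W where "W = mkset (standard S) pow"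
  define E where "E = (\<lambda>_. N)(rpar 0 := stdrel S (rel2 P), rpar 1 := W)"
  have Eaux: "E (raux 0) = N" and Epar: "E (rpar 1) = W" by (simp_all add: E_def)
  define \<rho> where "\<rho> = bfm_of 0 (R2 P 0 1)"
  \<comment> \<open>The last conjunct keeps the set apart from the numbers: in the nonstandard
    superstructure these are all the atoms, and an internal set must not be one.\<close>
  define \<phi> where "\<phi> = BAnd (BAll (rvar 1) (raux 0) (BOr (BAnd (BMem (rvar 1) (raux 7)) \<rho>)
       (BAnd (BNeg (BMem (rvar 1) (raux 7))) (BNeg \<rho>))))
     (BAnd (BAll (rvar 1) (raux 7) (BMem (rvar 1) (raux 0))) (BNeg (BMem (raux 7) (raux 0))))"
  have bsat_phi: "bsat V (e(rvar 0 := a, raux 7 := s)) \<phi> \<longleftrightarrow>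
      (\<forall>y. elem V y (e (raux 0)) \<longrightarrow>
        (elem V y s \<longleftrightarrow> bsat V (e(rvar 0 := a, raux 7 := s, rvar 1 := y)) \<rho>)) \<and>
      (\<forall>y. elem V y s \<longrightarrow> elem V y (e (raux 0))) \<and> \<not> elem V s (e (raux 0))"
    for V :: "'z set_structure" and e a s
    unfolding \<phi>_def by (simp add: fun_upd_same fun_upd_other del: fun_upd_apply) blast
  have num_level: "num S ` A \<subseteq> level (standard S) 0" if "A \<subseteq> Npos" for A
    using atoms_level0 that by blast
  have "pow \<subseteq> level (standard S) (Suc 0)"
    using mkset_in_level[OF std_super num_level] unfolding pow_def by blast
  then have W: "elem (standard S) s W \<longleftrightarrow> s \<in> pow" for s
    unfolding W_def by (rule elem_mkset_level[OF std_super])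
  have phi_std: "bsat (standard S) (E(rvar 0 := num S m, raux 7 := mkset (standard S) (num S ` {n \<in> Npos. P m n}))) \<phi>"
    if m: "m \<in> Npos" for m
  proof -
    let ?s = "mkset (standard S) (num S ` {n \<in> Npos. P m n})"
    have s: "elem (standard S) (num S n) ?s \<longleftrightarrow> P m n" if "n \<in> Npos" for n
      using elem_std_mkset[OF Collect_restrict that, of "P m"] that by simp
    have s': "\<exists>n\<in>Npos. y = num S n" if "elem (standard S) y ?s" for y
      using that elem_mkset_level[OF std_super num_level[OF Collect_restrict[of Npos "P m"]]] by auto
    have "?s \<notin> atoms (standard S)"
      using mkset_level[OF std_super num_level[OF Collect_restrict[of Npos "P m"]]] by blast
    moreover have "bsat (standard S) (E(rvar 0 := num S m, raux 7 := ?s, rvar 1 := num S n)) \<rho> \<longleftrightarrow> P m n"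
      if n: "n \<in> Npos" for n
    proof -
      have "bsat (standard S) (E(rvar 0 := num S m, raux 7 := ?s, rvar 1 := num S n)) \<rho> \<longleftrightarrow>
          gsat (standard S) N (stdrel S) (\<lambda>i. (E(rvar 0 := num S m, raux 7 := ?s, rvar 1 := num S n)) (rvar i)) (R2 P 0 1)"
        unfolding \<rho>_def by (rule bsat_bfm_of[OF std_super]) (simp_all add: E_def)
      also have "\<dots> \<longleftrightarrow> gsat (standard S) N (stdrel S) (num S \<circ> (\<lambda>_. 1)(0 := m, 1 := n)) (R2 P 0 1)"
        by simp
      also have "\<dots> \<longleftrightarrow> P m n"
        using nsat_gsat[of "(\<lambda>_. 1)(0 := m, 1 := n)" "R2 P 0 1"] m n by (simp add: N_def Npos_def)
      finally show ?thesis .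
    qed
    ultimately show ?thesis
      using s s' std_atoms unfolding bsat_phi Eaux N_def elem_std_Npos by auto
  qed
  have "bsat (standard S) E (BAll (rvar 0) (raux 0) (BEx (raux 7) (rpar 1) \<phi>))"
    unfolding bsat.simps bsat_BEx Eaux N_def elem_std_Npos
  proof (intro allI impI, elim bexE)
    fix y m assume m: "m \<in> Npos" "y = num S m"
    have "elem (standard S) (mkset (standard S) (num S ` {n \<in> Npos. P m n})) ((E(rvar 0 := y)) (rpar 1))"
      using Collect_restrict[of Npos "P m"] by (simp add: Epar W pow_def fun_upd_other del: fun_upd_apply One_nat_def)
    then show "\<exists>s. elem (standard S) s ((E(rvar 0 := y)) (rpar 1)) \<and> bsat (standard S) (E(rvar 0 := y, raux 7 := s)) \<phi>"
      using phi_std[OF m(1)] m(2) by blast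
  qed
  then have "bsat (nonstandard S) (star S \<circ> E) (BAll (rvar 0) (raux 0) (BEx (raux 7) (rpar 1) \<phi>))"
    by (simp only: bounded_transfer)
  then obtain s where s: "elem (nonstandard S) s (star S W)"
    and phi: "bsat (nonstandard S) ((star S \<circ> E)(rvar 0 := x, raux 7 := s)) \<phi>"
    using x by (auto simp: Eaux Epar N_def starset_def elts_def fun_upd_other simp del: fun_upd_apply One_nat_def)
  have R: "bsat (nonstandard S) ((star S \<circ> E)(rvar 0 := x, raux 7 := s, rvar 1 := y)) \<rho> \<longleftrightarrow>
      star2 S P x y" for y
  proof -
    have "bsat (nonstandard S) ((star S \<circ> E)(rvar 0 := x, raux 7 := s, rvar 1 := y)) \<rho> \<longleftrightarrow>
        gsat (nonstandard S) (star S N) (star S \<circ> stdrel S)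
          (\<lambda>i. ((star S \<circ> E)(rvar 0 := x, raux 7 := s, rvar 1 := y)) (rvar i)) (R2 P 0 1)"
      unfolding \<rho>_def by (rule bsat_bfm_of[OF nonstd_super]) (simp_all add: E_def)
    also have "\<dots> \<longleftrightarrow> star2 S P x y"
      by (simp add: star2_def starrel_stdrel)
    finally show ?thesis .
  qed
  have "internal_set S s"
    using s phi nonstd_atoms unfolding internal_set_def bsat_phi
    by (auto simp: E_def N_def hypernat_eq elts_def)
  moreover have "elts (nonstandard S) s = {y \<in> hypernat S. star2 S P x y}"
    using phi unfolding bsat_phi R hypernat_eq elts_def N_def[symmetric]
    by (auto simp: E_def)
  ultimately show ?thesis by blast
qed

text \<open>The default value is 1 because \<open>transfer\<close> requires positive
  assignments.\<close>

lemma nfm_transfer: "nsat (\<lambda>_. 1) a \<Longrightarrow> hsat S (\<lambda>_. std S 1) a"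
  using transfer[of "\<lambda>_. 1" a] by (simp add: comp_def)

text \<open>The universal closure is transferred, so a fact checked for natural numbers becomes
  available at nonstandard arguments.\<close>

lemma transfer1:
  assumes "\<And>m. m > 0 \<Longrightarrow> nsat ((\<lambda>_. 1)(0 := m)) a" and "x \<in> hypernat S"
  shows "hsat S ((\<lambda>_. std S 1)(0 := x)) a"
proof -
  have "hsat S (\<lambda>_. std S 1) (NAll 0 a)"
    by (rule nfm_transfer) (simp add: assms(1)[unfolded One_nat_def] del: fun_upd_apply)
  then show ?thesis using assms(2) by (simp only: hsat.simps)
qed

lemma transfer2:
  assumes "\<And>m n. m > 0 \<Longrightarrow> n > 0 \<Longrightarrow> nsat ((\<lambda>_. 1)(0 := m, 1 := n)) a"
    and "x \<in> hypernat S" "y \<in> hypernat S"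
  shows "hsat S ((\<lambda>_. std S 1)(0 := x, 1 := y)) a"
proof -
  have "hsat S ((\<lambda>_. std S 1)(0 := x)) (NAll 1 a)"
    by (rule transfer1[OF _ assms(2)]) (simp add: assms(1)[unfolded One_nat_def] del: fun_upd_apply)
  then show ?thesis using assms(3) by (simp only: hsat.simps)
qed

lemma transfer3:
  assumes "\<And>m n k. m > 0 \<Longrightarrow> n > 0 \<Longrightarrow> k > 0 \<Longrightarrow> nsat ((\<lambda>_. 1)(0 := m, 1 := n, 2 := k)) a"
    and "x \<in> hypernat S" "y \<in> hypernat S" "z \<in> hypernat S"
  shows "hsat S ((\<lambda>_. std S 1)(0 := x, 1 := y, 2 := z)) a"
proof -
  have "hsat S ((\<lambda>_. std S 1)(0 := x, 1 := y)) (NAll 2 a)"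
    by (rule transfer2[OF _ assms(2,3)]) (simp add: assms(1)[unfolded One_nat_def] del: fun_upd_apply)
  then show ?thesis using assms(4) by (simp only: hsat.simps)
qed

lemma starset_subset: "A \<subseteq> Npos \<Longrightarrow> starset S A \<subseteq> hypernat S"
proof -
  assume A: "A \<subseteq> Npos"
  define E where "E i = (if i = 1 then mkset (standard S) (num S ` A) else mkset (standard S) (num S ` Npos))" for i :: nat
  have "num S ` A \<subseteq> level (standard S) 0"
    using A atoms_level0 by blast
  then have "elem (standard S) y (E 1) \<longleftrightarrow> y \<in> num S ` A" for y
    using elem_mkset_level[OF std_super, of _ 0] by (simp add: E_def)
  then have "bsat (standard S) E (BAll 0 1 (BMem 0 2))"
    using A elem_std_Npos by (auto simp: E_def)
  then have "bsat (nonstandard S) (star S \<circ> E) (BAll 0 1 (BMem 0 2))"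
    by (simp only: bounded_transfer)
  then show ?thesis
    by (auto simp: E_def starset_def elts_def)
qed

lemma star1_hypernat: "star1 S P x \<Longrightarrow> x \<in> hypernat S"
  using starset_subset[OF Collect_restrict[of Npos P]] by (auto simp: star1_def)

lemma starset_star1: "A \<subseteq> Npos \<Longrightarrow> x \<in> starset S A \<longleftrightarrow> star1 S (\<lambda>n. n \<in> A) x"
  by (simp add: star1_def Collect_conj_eq Int_absorb1)

lemma star1_std: "n > 0 \<Longrightarrow> star1 S P (std S n) \<longleftrightarrow> P n"
  using transfer[of "\<lambda>_. n" "R1 P 0"] by simp

lemma star2_std: "m > 0 \<Longrightarrow> n > 0 \<Longrightarrow> star2 S P (std S m) (std S n) \<longleftrightarrow> P m n"
  using transfer[of "(\<lambda>_. n)(0 := m)" "R2 P 0 1"] by simp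

lemma std_hypernat: "n > 0 \<Longrightarrow> std S n \<in> hypernat S"
  using star1_std[of n "\<lambda>_. True"] star1_hypernat[of "\<lambda>_. True" "std S n"] by simp

lemma std_eq_iff: "m > 0 \<Longrightarrow> n > 0 \<Longrightarrow> std S m = std S n \<longleftrightarrow> m = n"
  using transfer[of "(\<lambda>_. n)(0 := m)" "NEq 0 1"] by simp

lemma star1_conj:
  assumes "x \<in> hypernat S"
  shows "star1 S (\<lambda>n. P n \<and> Q n) x \<longleftrightarrow> star1 S P x \<and> star1 S Q x"
proof -
  have "hsat S ((\<lambda>_. std S 1)(0 := x)) (NIff (R1 (\<lambda>n. P n \<and> Q n) 0) (NAnd (R1 P 0) (R1 Q 0)))"
    by (rule transfer1[OF _ assms]) simp
  then show ?thesis by simp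
qed

lemma star1_not:
  assumes "x \<in> hypernat S"
  shows "star1 S (\<lambda>n. \<not> P n) x \<longleftrightarrow> \<not> star1 S P x"
proof -
  have "hsat S ((\<lambda>_. std S 1)(0 := x)) (NIff (R1 (\<lambda>n. \<not> P n) 0) (NNeg (R1 P 0)))"
    by (rule transfer1[OF _ assms]) simp
  then show ?thesis by simp
qed

lemma star1_mono:
  assumes "star1 S P x" and "\<And>n. n > 0 \<Longrightarrow> P n \<Longrightarrow> Q n"
  shows "star1 S Q x"
proof -
  have "hsat S ((\<lambda>_. std S 1)(0 := x)) (NImp (R1 P 0) (R1 Q 0))"
    by (rule transfer1[OF _ star1_hypernat[OF assms(1)]]) (simp add: assms(2))
  then show ?thesis using assms(1) by simp
qed

lemma star2_mono:
  assumes "star2 S P x y" "x \<in> hypernat S" "y \<in> hypernat S"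
    and "\<And>m n. m > 0 \<Longrightarrow> n > 0 \<Longrightarrow> P m n \<Longrightarrow> Q m n"
  shows "star2 S Q x y"
proof -
  have "hsat S ((\<lambda>_. std S 1)(0 := x, 1 := y)) (NImp (R2 P 0 1) (R2 Q 0 1))"
    by (rule transfer2[OF _ assms(2,3)]) (simp add: assms(4))
  then show ?thesis using assms(1) by simp
qed

lemma tp_betaN:
  assumes x: "x \<in> hypernat S"
  shows "tp S x \<in> betaN"
  unfolding betaN_def mem_Collect_eq ultrafilter_on_def
proof (intro conjI ballI allI impI)
  show "tp S x \<subseteq> Pow Npos" by (auto simp: tp_def)
  show "Npos \<in> tp S x" using x by (simp add: tp_def)
  show "{} \<notin> tp S x"
    using transfer1[of "NNeg (R1 (\<lambda>n. n \<in> {}) 0)" x] x by (simp add: tp_def starset_star1)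
  fix A B assume "A \<in> tp S x" "B \<in> tp S x"
  then show "A \<inter> B \<in> tp S x"
    using star1_conj[OF x, of "\<lambda>n. n \<in> A" "\<lambda>n. n \<in> B"]
    by (auto simp: tp_def starset_star1 le_infI1)
next
  fix A B assume "A \<in> tp S x" "A \<subseteq> B \<and> B \<subseteq> Npos"
  then show "B \<in> tp S x"
    using star1_mono[of "\<lambda>n. n \<in> A" x "\<lambda>n. n \<in> B"] subsetD[of A B] by (auto simp: tp_def starset_star1)
next
  fix A assume A: "A \<subseteq> Npos"
  show "A \<in> tp S x \<or> Npos - A \<in> tp S x"
    using star1_not[OF x, of "\<lambda>n. n \<in> A"] star1_mono[of "\<lambda>n. n \<notin> A" x "\<lambda>n. n \<in> Npos - A"] A
    by (auto simp: tp_def starset_star1 Npos_def)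
qed

end

section \<open>Saturation and generators\<close>

locale saturated_hyperextension = hyperextension +
  assumes saturated: "c_plus_saturated S"
begin

text \<open>The conditions are sections at \<open>x\<close> of standard relations. They are internal
  by \<open>internal_section\<close> and at most continuum many, hence any family of relations is
  admissible.\<close>

lemma saturation:
  fixes \<R> :: "(nat \<Rightarrow> nat \<Rightarrow> bool) set"
  assumes x: "x \<in> hypernat S"
    and fip: "\<And>\<D>. finite \<D> \<Longrightarrow> \<D> \<subseteq> \<R> \<Longrightarrow> \<exists>y\<in>hypernat S. \<forall>R\<in>\<D>. star2 S R x y"
  shows "\<exists>y\<in>hypernat S. \<forall>R\<in>\<R>. star2 S R x y"
proof -
  define sec where "sec R = (SOME s. internal_set S s \<and> elts (nonstandard S) s = {y \<in> hypernat S. star2 S R x y})" for R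
  have sec: "internal_set S (sec R)" "elts (nonstandard S) (sec R) = {y \<in> hypernat S. star2 S R x y}" for R
    using someI_ex[OF internal_section[OF x, of R]] unfolding sec_def by blast+
  have top: "star2 S (\<lambda>_ _. True) x y" if "y \<in> hypernat S" for y
    using transfer2[of "R2 (\<lambda>_ _. True) 0 1" x y] x that by simp
  \<comment> \<open>The trivial relation forces the common element to be a hypernatural even if
    \<open>\<R>\<close> is empty.\<close>
  define \<C> where "\<C> = sec ` insert (\<lambda>_ _. True) \<R>"
  \<comment> \<open>Coding pairs by numbers embeds the relations into the sets of naturals, which
    gives the bound in \<open>c_plus_saturated\<close>.\<close>
  define code where "code R = {prod_encode (m, n) | m n. R m n}" for R :: "nat \<Rightarrow> nat \<Rightarrow> bool"
  have "inj code"
  proof (rule injI)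
    fix R R' assume "code R = code R'"
    then have "prod_encode (m, n) \<in> code R \<longleftrightarrow> prod_encode (m, n) \<in> code R'" for m n by simp
    then show "R = R'" by (auto simp: code_def fun_eq_iff)
  qed
  then have "(UNIV :: (nat \<Rightarrow> nat \<Rightarrow> bool) set) \<lesssim> (UNIV :: nat set set)"
    unfolding lepoll_def by blast
  then have "\<C> \<lesssim> (UNIV :: nat set set)"
    unfolding \<C>_def by (meson image_lepoll lepoll_trans subset_UNIV subset_imp_lepoll)
  moreover have "(\<Inter>s\<in>\<D>. elts (nonstandard S) s) \<noteq> {}" if D: "\<D> \<subseteq> \<C>" "finite \<D>" "\<D> \<noteq> {}" for \<D>
  proof -
    obtain \<D>' where D': "\<D>' \<subseteq> insert (\<lambda>_ _. True) \<R>" "finite \<D>'" "\<D> = sec ` \<D>'"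
      using finite_subset_image[OF D(2)] D(1) unfolding \<C>_def by metis
    obtain y where y: "y \<in> hypernat S" "\<forall>R\<in>\<D>' - {\<lambda>_ _. True}. star2 S R x y"
      using fip[of "\<D>' - {\<lambda>_ _. True}"] D' by blast
    then have "\<forall>R\<in>\<D>'. star2 S R x y" using top by blast
    then have "y \<in> (\<Inter>s\<in>\<D>. elts (nonstandard S) s)" using y(1) by (auto simp: D'(3) sec(2))
    then show ?thesis by blast
  qed
  moreover have "\<forall>s\<in>\<C>. internal_set S s" using sec(1) by (auto simp: \<C>_def)
  ultimately have "(\<Inter>s\<in>\<C>. elts (nonstandard S) s) \<noteq> {}"
    using saturated[unfolded c_plus_saturated_def, THEN spec[of _ \<C>]] by simp
  then show ?thesis by (auto simp: \<C>_def sec(2))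
qed

lemma generator_exists:
  assumes F: "F \<in> betaN"
  shows "\<exists>x. x \<in> generators S F"
proof -
  have inter: "\<Inter>\<A> \<inter> Npos \<in> F" if "finite \<A>" "\<A> \<subseteq> F" for \<A>
    using that
  proof induction
    case (insert A \<A>)
    then show ?case using betaN_Int[OF F, of A "\<Inter>\<A> \<inter> Npos"] by (simp add: Int_assoc)
  qed (simp add: betaN_top[OF F])
  \<comment> \<open>The relations ignore their first argument; \<open>std S 1\<close> is a dummy
    parameter.\<close>
  have "\<exists>y\<in>hypernat S. \<forall>R\<in>(\<lambda>A m n. n \<in> A) ` F. star2 S R (std S 1) y"
  proof (rule saturation)
    fix \<D> assume D: "finite \<D>" "\<D> \<subseteq> (\<lambda>A (m::nat) n. n \<in> A) ` F"
    then obtain \<A> where A: "\<A> \<subseteq> F" "finite \<A>" "\<D> = (\<lambda>A m n. n \<in> A) ` \<A>"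
      using finite_subset_image[OF D] by metis
    then obtain n where n: "n \<in> \<Inter>\<A> \<inter> Npos" using inter[of \<A>] betaN_empty[OF F] by (metis all_not_in_conv)
    then have "n > 0" by (simp add: Npos_def)
    then show "\<exists>y\<in>hypernat S. \<forall>R\<in>\<D>. star2 S R (std S 1) y"
      using n A(3) std_hypernat by (intro bexI[of _ "std S n"]) (auto simp: star2_std)
  qed (simp add: std_hypernat)
  then obtain y where y: "y \<in> hypernat S" "\<And>A. A \<in> F \<Longrightarrow> star2 S (\<lambda>m n. n \<in> A) (std S 1) y" by auto
  have "y \<in> starset S A" if "A \<in> F" for A
    using transfer2[of "NImp (R2 (\<lambda>m n. n \<in> A) 0 1) (R1 (\<lambda>n. n \<in> A) 1)" "std S 1" y]
      y(2)[OF that] y(1) std_hypernat[of 1] betaN_subset[OF F that] by (auto simp: starset_star1)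
  then have "F \<subseteq> tp S y" using betaN_subset[OF F] by (auto simp: tp_def)
  then have "F = tp S y" by (rule betaN_eqI[OF F tp_betaN[OF y(1)]])
  then show ?thesis using y(1) by (auto simp: generators_def)
qed

end

section \<open>Antichains\<close>

definition antichain :: "nat set \<Rightarrow> bool" where
  "antichain A \<longleftrightarrow> (\<forall>m\<in>A. \<forall>n\<in>A. m dvd n \<longrightarrow> m = n)"

lemma subset_up: "A \<subseteq> Npos \<Longrightarrow> A \<subseteq> up A"
proof
  fix n assume "A \<subseteq> Npos" "n \<in> A"
  then show "n \<in> up A" by (auto simp: up_def intro!: bexI[of _ n])
qed

lemma up_upsets:
  assumes "A \<subseteq> Npos" "A \<noteq> {}"
  shows "up A \<in> upsets"
proof -
  have "A \<subseteq> up A" by (rule subset_up[OF assms(1)])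
  moreover have N: "up A \<subseteq> Npos" by (auto simp: up_def)
  moreover have "up (up A) \<subseteq> up A" unfolding up_def using dvd_trans by blast
  then have "up A = up (up A)" using subset_up[OF N] by simp
  ultimately show ?thesis using assms(2) unfolding upsets_def by blast
qed

lemma upsets_dvd: "A \<in> upsets \<Longrightarrow> m \<in> A \<Longrightarrow> m dvd n \<Longrightarrow> n > 0 \<Longrightarrow> n \<in> A"
  unfolding upsets_def up_def Npos_def by blast

lemma uf_equiv_upsets: "uf_equiv F G \<Longrightarrow> A \<in> upsets \<Longrightarrow> A \<in> F \<longleftrightarrow> A \<in> G"
  by (auto simp: uf_equiv_def uf_dvd_def)

lemma uf_equiv_sym: "uf_equiv F G \<Longrightarrow> uf_equiv G F"
  by (simp add: uf_equiv_def)

lemma uf_equiv_trans: "uf_equiv F G \<Longrightarrow> uf_equiv G H \<Longrightarrow> uf_equiv F H"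
  unfolding uf_equiv_def uf_dvd_def by blast

text \<open>
  For an antichain \<open>B\<close>, the difference of the upward closed sets of all multiples and of all proper
  multiples of elements of \<open>B\<close> is \<open>B\<close>.
\<close>

lemma uf_equiv_antichain:
  assumes F: "F \<in> betaN" and G: "G \<in> betaN" and eq: "uf_equiv F G"
    and A: "A \<in> F" "antichain A"
  shows "F = G"
proof (rule betaN_eqI[OF F G], rule subsetI)
  fix C assume "C \<in> F"
  define B where "B = A \<inter> C"
  have "B \<in> F" unfolding B_def by (rule betaN_Int[OF F A(1) \<open>C \<in> F\<close>])
  moreover have "antichain B" using A(2) by (simp add: B_def antichain_def)
  ultimately have B: "B \<in> F" "antichain B" by simp_all
  have BN: "B \<subseteq> Npos" "B \<noteq> {}" using betaN_subset[OF F B(1)] betaN_empty[OF F] B(1) by metis+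
  define D where "D = {n \<in> Npos. \<exists>b\<in>B. b dvd n \<and> b \<noteq> n}"
  have "B \<subseteq> up B" by (rule subset_up[OF BN(1)])
  then have "up B \<in> F" using betaN_mono[OF F B(1)] by (auto simp: up_def)
  then have "up B \<in> G" using uf_equiv_upsets[OF eq up_upsets[OF BN]] by simp
  have "D \<in> upsets"
  proof -
    \<comment> \<open>Members of \<open>upsets\<close> are nonempty, so some proper multiple has to
      be exhibited.\<close>
    obtain b where "b \<in> B" "b > 0" using BN by (auto simp: Npos_def)
    then have ne: "2 * b \<in> D" unfolding D_def by (simp add: Npos_def) (intro bexI[of _ b], simp_all)
    have "n \<in> D" if n: "n \<in> Npos" and m: "m \<in> D" and dvd: "m dvd n" for m n
    proof -
      obtain c where c: "c \<in> B" "c dvd m" "c \<noteq> m" unfolding D_def using m D_def by blast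
      have "m > 0" using m by (simp add: D_def Npos_def)
      then have "c < m" using dvd_imp_le[OF c(2)] c(3) by simp
      moreover have "m \<le> n" using dvd_imp_le[OF dvd] n by (simp add: Npos_def)
      ultimately have "c \<noteq> n" by simp
      moreover have "c dvd n" using dvd_trans[OF c(2) dvd] .
      ultimately show ?thesis unfolding D_def using c(1) n by blast
    qed
    then have "up D \<subseteq> D" unfolding up_def by blast
    moreover have DN: "D \<subseteq> Npos" unfolding D_def by blast
    ultimately show ?thesis using subset_up[OF DN] ne unfolding upsets_def by blast
  qed
  moreover have "D \<notin> F"
  proof
    assume "D \<in> F"
    moreover have "B \<inter> D = {}" using B(2) unfolding D_def antichain_def by blast
    ultimately show False using betaN_Int[OF F B(1)] betaN_empty[OF F] by metis
  qed
  ultimately have "Npos - D \<in> G"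
    using uf_equiv_upsets[OF eq, of D] betaN_compl[OF G, of D] unfolding upsets_def by blast
  then have "up B \<inter> (Npos - D) \<in> G" using \<open>up B \<in> G\<close> betaN_Int[OF G] by blast
  then show "C \<in> G"
  proof (rule betaN_mono[OF G])
    show "up B \<inter> (Npos - D) \<subseteq> C" unfolding up_def D_def B_def by blast
    show "C \<subseteq> Npos" by (rule betaN_subset[OF F \<open>C \<in> F\<close>])
  qed
qed

lemma betaN_finite_UN:
  assumes F: "F \<in> betaN" and "finite I" "(\<Union>i\<in>I. A i) \<in> F"
  shows "\<exists>i\<in>I. A i \<in> F"
  using assms(2,3)
proof (induction I)
  case empty
  then show ?case using betaN_empty[OF F] by simp
next
  case (insert i I)
  have N: "A i \<subseteq> Npos" "(\<Union>i\<in>I. A i) \<subseteq> Npos" using betaN_subset[OF F insert.prems] by auto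
  show ?case
  proof (cases "A i \<in> F")
    case False
    then have "Npos - A i \<in> F" using betaN_compl[OF F N(1)] by simp
    then have "(\<Union>i\<in>insert i I. A i) \<inter> (Npos - A i) \<in> F" using betaN_Int[OF F insert.prems] by simp
    then have "(\<Union>i\<in>I. A i) \<in> F" by (rule betaN_mono[OF F _ _ N(2)]) auto
    then show ?thesis using insert.IH by blast
  qed simp
qed

text \<open>Components are stored as prime powers, not as pairs of prime and exponent: membership is
  then a binary relation between naturals, ready for \<open>R2\<close> and for
  \<open>saturation\<close>.\<close>

definition components :: "nat \<Rightarrow> nat set" where
  "components n = (\<lambda>p. p ^ multiplicity p n) ` prime_factors n"

lemma finite_components: "finite (components n)"
  by (simp add: components_def)

text \<open>The form to be matched with \<open>exactly_divides\<close>; exponent and cofactor are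
  positive, as are the values of quantified variables in transferred formulas.\<close>

lemma components_iff:
  assumes "n > 0"
  shows "y \<in> components n \<longleftrightarrow>
    (\<exists>p a. prime p \<and> a > 0 \<and> y = p ^ a \<and> (\<exists>m>0. n = p ^ a * m \<and> \<not> p dvd m))"
proof
  assume "y \<in> components n"
  then obtain p where p: "p \<in> prime_factors n" "y = p ^ multiplicity p n" by (auto simp: components_def)
  have "prime p" "p dvd n" using p(1) by auto
  then have "multiplicity p n > 0" using assms by (simp add: prime_multiplicity_gt_zero_iff)
  moreover obtain m where "n = p ^ multiplicity p n * m" "\<not> p dvd m"
    using multiplicity_decompose'[of n p] \<open>prime p\<close> assms by (metis not_prime_unit gr_implies_not0)
  moreover have "m > 0" using calculation assms by (cases m) auto
  ultimately show "\<exists>p a. prime p \<and> a > 0 \<and> y = p ^ a \<and> (\<exists>m>0. n = p ^ a * m \<and> \<not> p dvd m)"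
    using p(2) \<open>prime p\<close> by blast
next
  assume "\<exists>p a. prime p \<and> a > 0 \<and> y = p ^ a \<and> (\<exists>m>0. n = p ^ a * m \<and> \<not> p dvd m)"
  then obtain p a m where *: "prime p" "a > 0" "y = p ^ a" "n = p ^ a * m" "\<not> p dvd m" by blast
  then have "multiplicity p n = a"
    by (intro multiplicity_eqI) (auto simp: mult_dvd_mono dest: prime_gt_0_nat)
  moreover have "p \<in> prime_factors n" using * assms by (auto simp: prime_factors_dvd)
  ultimately show "y \<in> components n" using *(3) by (auto simp: components_def)
qed

lemma inj_on_prime_power: "inj_on (\<lambda>p. p ^ multiplicity p n) (prime_factors (n::nat))"
proof (rule inj_onI)
  fix p q assume *: "p \<in> prime_factors n" "q \<in> prime_factors n" "p ^ multiplicity p n = q ^ multiplicity q n"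
  then have "multiplicity p n > 0" by (auto simp: prime_factors_multiplicity)
  then have "p dvd q ^ multiplicity q n" using *(3) by (metis dvd_power)
  then show "p = q" using * by (metis in_prime_factors_imp_prime prime_dvd_power primes_dvd_imp_eq)
qed

lemma prod_components: "n > 0 \<Longrightarrow> \<Prod>(components n) = n"
  unfolding components_def
  by (simp add: prod.reindex[OF inj_on_prime_power] prime_factorization_nat[symmetric])

text \<open>The product of the selected prime powers has just these components. Transferred, this
  builds divisors of a hypernatural with prescribed components.\<close>

lemma components_subset_ex:
  assumes "Y \<subseteq> components n"
  shows "\<exists>w>0. components w = Y"
proof -
  define Q where "Q = {p \<in> prime_factors n. p ^ multiplicity p n \<in> Y}"
  have Y: "Y = (\<lambda>p. p ^ multiplicity p n) ` Q" using assms by (auto simp: Q_def components_def)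
  define w where "w = (\<Prod>p\<in>Q. p ^ multiplicity p n)"
  have "Q \<subseteq> prime_factors n" by (auto simp: Q_def)
  then have "finite Q" by (rule finite_subset) simp
  have Q: "\<And>p. p \<in> Q \<Longrightarrow> prime p" "\<And>p. p \<in> Q \<Longrightarrow> multiplicity p n > 0"
    by (auto simp: Q_def prime_factors_multiplicity)
  have "w > 0" unfolding w_def using Q(1) by (intro prod_pos) (simp add: prime_gt_0_nat)
  have mult: "multiplicity p w = (if p \<in> Q then multiplicity p n else 0)" if "prime p" for p
    unfolding w_def using \<open>finite Q\<close> Q that by (simp add: multiplicity_prod_prime_powers)
  then have "prime_factors w = Q" using Q by (auto simp: prime_factors_multiplicity split: if_splits)
  then have "components w = Y" using mult Q(1) by (auto simp: components_def Y)
  then show ?thesis using \<open>w > 0\<close> by blast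
qed

text \<open>The powers of \<open>q\<close> form a chain under divisibility, and an antichain meets a
  chain at most once.\<close>

lemma card_prime_powers_antichain:
  assumes "antichain M"
  shows "finite {y \<in> M. \<exists>d>0. y = q ^ d} \<and> card {y \<in> M. \<exists>d>0. y = (q::nat) ^ d} \<le> 1"
proof -
  define X where "X = {y \<in> M. \<exists>d>0. y = q ^ d}"
  have "y = z" if yz: "y \<in> {y \<in> M. \<exists>d>0. y = q ^ d}" "z \<in> {y \<in> M. \<exists>d>0. y = q ^ d}" for y z
  proof -
    obtain c d where "y = q ^ c" "z = q ^ d" using yz by blast
    then have "y dvd z \<or> z dvd y"
      using le_imp_power_dvd[of c d q] le_imp_power_dvd[of d c q] nat_le_linear[of c d] by blast
    moreover have "y \<in> M" "z \<in> M" using yz by simp_all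
    ultimately show ?thesis using assms unfolding antichain_def by metis
  qed
  then have "X = {} \<or> (\<exists>y. X = {y})" unfolding X_def by blast
  then have "finite X \<and> card X \<le> 1" by auto
  then show ?thesis by (simp only: X_def)
qed

text \<open>
  A number in \<open>E\<close> has a bounded number of proper divisors in \<open>E\<close>, as their components are among
  boundedly many prime powers. The elements of \<open>E\<close> with a given number of such divisors form an
  antichain.
\<close>

lemma antichain_of_components:
  assumes F: "F \<in> betaN" and fin: "finite \<M>" and anti: "\<And>M. M \<in> \<M> \<Longrightarrow> antichain M"
    and EF: "{n \<in> Npos. card (components n) \<le> k \<and> components n \<subseteq> \<Union>\<M>} \<in> F"
  shows "\<exists>A\<in>F. antichain A"
proof -
  define E where "E = {n \<in> Npos. card (components n) \<le> k \<and> components n \<subseteq> \<Union>\<M>}"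
  define D where "D n = {e \<in> E. e dvd n \<and> e \<noteq> n}" for n
  have finD: "finite (D n)" if "n \<in> E" for n
    using that by (intro finite_subset[OF _ finite_atMost[of n]]) (auto simp: D_def E_def Npos_def dest: dvd_imp_le)
  have bound: "card (D n) \<le> 2 ^ (k * card \<M>)" if n: "n \<in> E" for n
  proof -
    \<comment> \<open>All places where a component of a divisor of \<open>n\<close> in
      \<open>E\<close> can lie: each of the at most \<open>k\<close> primes of \<open>n\<close> has
      at most one positive power in each antichain. Hence the constant \<open>k * card \<M>\<close>,
      and the power of 2 counts sets of components.\<close>
    define W where "W = (\<Union>q\<in>prime_factors n. \<Union>M\<in>\<M>. {y \<in> M. \<exists>d>0. y = q ^ d})"
    have "card (prime_factors n) \<le> k"
      using n card_image[OF inj_on_prime_power, of n] by (simp add: E_def components_def)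
    have finW: "finite W" using fin anti card_prime_powers_antichain by (auto simp: W_def)
    have "card W \<le> (\<Sum>q\<in>prime_factors n. card (\<Union>M\<in>\<M>. {y \<in> M. \<exists>d>0. y = q ^ d}))"
      unfolding W_def by (rule card_UN_le) simp
    also have "\<dots> \<le> (\<Sum>q\<in>prime_factors n. card \<M>)"
    proof (rule sum_mono)
      fix q
      have "card (\<Union>M\<in>\<M>. {y \<in> M. \<exists>d>0. y = q ^ d}) \<le> (\<Sum>M\<in>\<M>. card {y \<in> M. \<exists>d>0. y = q ^ d})"
        by (rule card_UN_le[OF fin])
      also have "\<dots> \<le> (\<Sum>M\<in>\<M>. 1)" using anti card_prime_powers_antichain by (intro sum_mono) blast
      finally show "card (\<Union>M\<in>\<M>. {y \<in> M. \<exists>d>0. y = q ^ d}) \<le> card \<M>" by simp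
    qed
    also have "\<dots> \<le> k * card \<M>" using \<open>card (prime_factors n) \<le> k\<close> by simp
    finally have cardW: "card W \<le> k * card \<M>" .
    have sub: "components e \<subseteq> W" if "e \<in> D n" for e
    proof
      fix y assume y: "y \<in> components e"
      have e: "e \<in> E" "e dvd n" using that by (auto simp: D_def)
      then obtain M where M: "M \<in> \<M>" "y \<in> M" using y by (auto simp: E_def)
      obtain p where p: "p \<in> prime_factors e" "y = p ^ multiplicity p e"
        using y by (auto simp: components_def)
      have "p \<in> prime_factors n"
        using p(1) n dvd_trans[OF _ e(2), of p] by (auto simp: prime_factors_dvd E_def Npos_def)
      moreover have "multiplicity p e > 0" using p(1) by (auto simp: prime_factors_multiplicity)
      then have "y \<in> {y \<in> M. \<exists>d>0. y = p ^ d}" using M(2) p(2) by blast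
      ultimately show "y \<in> W" unfolding W_def using M(1) by blast
    qed
    have "inj_on components (D n)"
    proof (rule inj_onI)
      fix d e assume "d \<in> D n" "e \<in> D n" "components d = components e"
      then have "d > 0" "e > 0" "\<Prod>(components d) = \<Prod>(components e)" by (simp_all add: D_def E_def Npos_def)
      then show "d = e" by (simp only: prod_components)
    qed
    moreover have "components ` D n \<subseteq> Pow W" using sub by blast
    ultimately have "card (D n) \<le> card (Pow W)" by (rule card_inj_on_le) (simp add: finW)
    also have "\<dots> = 2 ^ card W" by (rule card_Pow[OF finW])
    also have "\<dots> \<le> 2 ^ (k * card \<M>)" using cardW by (intro power_increasing) auto
    finally show ?thesis .
  qed
  \<comment> \<open>The divisor counts take finitely many values, so one of the fibres of
    \<open>E\<close> belongs to \<open>F\<close>.\<close>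
  have EU: "(\<Union>c\<in>{..2 ^ (k * card \<M>)}. {n \<in> E. card (D n) = c}) = E" by (auto simp: bound)
  have "(\<Union>c\<in>{..2 ^ (k * card \<M>)}. {n \<in> E. card (D n) = c}) \<in> F"
    unfolding EU unfolding E_def by (rule EF)
  from betaN_finite_UN[OF F finite_atMost this]
  obtain c where c: "{n \<in> E. card (D n) = c} \<in> F" by blast
  have "antichain {n \<in> E. card (D n) = c}"
    unfolding antichain_def
  proof (intro ballI impI, rule ccontr)
    fix d n assume *: "d \<in> {n \<in> E. card (D n) = c}" "n \<in> {n \<in> E. card (D n) = c}" "d dvd n" "d \<noteq> n"
    \<comment> \<open>Proper divisibility inside a fibre would strictly enlarge the divisor set, as
      \<open>d\<close> itself is new in \<open>D n\<close>.\<close>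
    have "D d \<subseteq> D n"
    proof
      fix e assume "e \<in> D d"
      then have e: "e \<in> E" "e dvd d" "e \<noteq> d" by (simp_all add: D_def)
      moreover have "e dvd n" using dvd_trans[OF e(2) *(3)] .
      moreover have "e \<noteq> n" using e(2) *(3,4) dvd_antisym by blast
      ultimately show "e \<in> D n" by (simp add: D_def)
    qed
    moreover have "d \<in> D n - D d" using * by (auto simp: D_def)
    ultimately have "D d \<subset> D n" by blast
    then have "card (D d) < card (D n)" using finD * by (intro psubset_card_mono) auto
    then show False using * by simp
  qed
  then show ?thesis using c by blast
qed

section \<open>Cardinality of initial segments\<close>

lemma finite_fv_tm: "finite (fv_tm t)"
  by (induction t) auto

lemma finite_fv_fm: "finite (fv_fm \<phi>)"
  by (induction \<phi>) (auto simp: finite_fv_tm)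

lemma wf_tm_empty_language: "wf_tm ([], []) t \<Longrightarrow> \<exists>i. t = Var i"
  by (cases t) auto

text \<open>One back-and-forth move: a value already taken is copied, and a new one is answered by
  an element of \<open>univ N\<close> outside the finitely many values of \<open>e'\<close> on
  \<open>X\<close>.\<close>

lemma extend_same_equalities:
  assumes "finite X" "infinite (univ N)" "x \<in> univ M" "range e' \<subseteq> univ N"
    and "\<And>j k. j \<in> X - {i} \<Longrightarrow> k \<in> X - {i} \<Longrightarrow> e j = e k \<longleftrightarrow> e' j = e' k"
  shows "\<exists>x'\<in>univ N. \<forall>j\<in>X. \<forall>k\<in>X. (e(i := x)) j = (e(i := x)) k \<longleftrightarrow> (e'(i := x')) j = (e'(i := x')) k"
proof (cases "\<exists>j\<in>X - {i}. x = e j")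
  case True
  then obtain j where j: "j \<in> X - {i}" "x = e j" by blast
  have "(e(i := x)) k = (e(i := x)) l \<longleftrightarrow> (e'(i := e' j)) k = (e'(i := e' j)) l"
    if "k \<in> X" "l \<in> X" for k l
    using assms(5)[of k l] assms(5)[of j l] assms(5)[of k j] j that by auto
  then show ?thesis using assms(4) by (intro bexI[of _ "e' j"]) auto
next
  case False
  have "finite (e' ` X)" using assms(1) by simp
  then obtain x' where x': "x' \<in> univ N" "x' \<notin> e' ` X"
    using assms(2) by (meson finite_subset subsetI)
  have "(e(i := x)) k = (e(i := x)) l \<longleftrightarrow> (e'(i := x')) k = (e'(i := x')) l"
    if "k \<in> X" "l \<in> X" for k l
    using assms(5)[of k l] False x'(2) that by auto
  then show ?thesis using x'(1) by blast
qed

text \<open>Without function and relation symbols a formula sees only which of its free variables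
  coincide; in infinite domains every choice for a quantified variable can be matched on the other
  side.\<close>

lemma sat_infinite_pure_sets:
  assumes "infinite (univ M)" "infinite (univ N)"
  shows "wf_fm ([], []) \<phi> \<Longrightarrow> range e \<subseteq> univ M \<Longrightarrow> range e' \<subseteq> univ N \<Longrightarrow>
    (\<And>i j. i \<in> fv_fm \<phi> \<Longrightarrow> j \<in> fv_fm \<phi> \<Longrightarrow> e i = e j \<longleftrightarrow> e' i = e' j) \<Longrightarrow> sat M e \<phi> \<longleftrightarrow> sat N e' \<phi>"
proof (induction \<phi> arbitrary: e e')
  case (FEq s t)
  have "wf_tm ([], []) s" "wf_tm ([], []) t" using FEq.prems(1) by simp_all
  then obtain i j where "s = Var i" "t = Var j" using wf_tm_empty_language by metis
  then show ?case using FEq.prems(4)[of i j] by simp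
next
  case (FAnd \<phi> \<psi>)
  then show ?case using FAnd.IH(1)[of e e'] FAnd.IH(2)[of e e'] by simp
next
  case (FAll i \<phi>)
  have IH: "sat M (e(i := x)) \<phi> \<longleftrightarrow> sat N (e'(i := x')) \<phi>"
    if "x \<in> univ M" "x' \<in> univ N"
      and eq: "\<forall>j\<in>fv_fm \<phi>. \<forall>k\<in>fv_fm \<phi>. (e(i := x)) j = (e(i := x)) k \<longleftrightarrow> (e'(i := x')) j = (e'(i := x')) k"
    for x x'
  proof (rule FAll.IH)
    show "range (e(i := x)) \<subseteq> univ M" "range (e'(i := x')) \<subseteq> univ N"
      using that FAll.prems by (auto simp: image_subset_iff)
  qed (use eq FAll.prems in auto)
  have 1: "\<exists>x'\<in>univ N. sat M (e(i := x)) \<phi> \<longleftrightarrow> sat N (e'(i := x')) \<phi>" if x: "x \<in> univ M" for x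
    using extend_same_equalities[of "fv_fm \<phi>" N x M e' i e, OF finite_fv_fm assms(2) x FAll.prems(3)]
      FAll.prems(4) IH[OF x] by auto
  have 2: "\<exists>x\<in>univ M. sat M (e(i := x)) \<phi> \<longleftrightarrow> sat N (e'(i := x')) \<phi>" if x': "x' \<in> univ N" for x'
  proof -
    have "\<exists>x\<in>univ M. \<forall>j\<in>fv_fm \<phi>. \<forall>k\<in>fv_fm \<phi>.
        (e'(i := x')) j = (e'(i := x')) k \<longleftrightarrow> (e(i := x)) j = (e(i := x)) k"
      by (rule extend_same_equalities[OF finite_fv_fm assms(1) x' FAll.prems(2)])
        (use FAll.prems(4) in auto)
    then obtain x where x: "x \<in> univ M" "\<forall>j\<in>fv_fm \<phi>. \<forall>k\<in>fv_fm \<phi>.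
        (e'(i := x')) j = (e'(i := x')) k \<longleftrightarrow> (e(i := x)) j = (e(i := x)) k" ..
    have "sat M (e(i := x)) \<phi> \<longleftrightarrow> sat N (e'(i := x')) \<phi>"
      by (rule IH[OF x(1) x']) (use x(2) in metis)
    then show ?thesis using x(1) by blast
  qed
  show ?case using 1 2 by (simp only: sat.simps) metis
qed auto

lemma elementarily_equivalent_infinite_pure_sets:
  assumes "infinite (univ M)" "infinite (univ N)"
  shows "elementarily_equivalent ([], []) M N"
  unfolding elementarily_equivalent_def
proof (intro allI impI)
  fix \<phi> assume \<phi>: "wf_fm ([], []) \<phi> \<and> fv_fm \<phi> = {}"
  have "univ M \<noteq> {}" "univ N \<noteq> {}" using assms by auto
  then obtain x y where "x \<in> univ M" "y \<in> univ N" by blast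
  then have r: "range (\<lambda>_. x) \<subseteq> univ M" "range (\<lambda>_. y) \<subseteq> univ N" by auto
  have "sat M e \<phi> \<longleftrightarrow> sat N e' \<phi>" if "range e \<subseteq> univ M" "range e' \<subseteq> univ N" for e e'
    by (rule sat_infinite_pure_sets[OF assms]) (use \<phi> that in auto)
  then show "holds M \<phi> \<longleftrightarrow> holds N \<phi>"
    unfolding holds_def using r by blast
qed

section \<open>Standard and infinite hypernaturals; sizes of initial segments\<close>

context hyperextension begin

lemma star2_swap:
  assumes "x \<in> hypernat S" "y \<in> hypernat S"
  shows "star2 S (\<lambda>m n. P n m) y x \<longleftrightarrow> star2 S P x y"
proof -
  have "hsat S ((\<lambda>_. std S 1)(0 := x, 1 := y)) (NIff (R2 (\<lambda>m n. P n m) 1 0) (R2 P 0 1))"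
    by (rule transfer2[OF _ assms]) simp
  then show ?thesis by simp
qed

lemma star2_std_left:
  assumes "m > 0" "y \<in> hypernat S"
  shows "star2 S P (std S m) y \<longleftrightarrow> star1 S (P m) y"
proof -
  have "hsat S (std S \<circ> (\<lambda>_. 1)(0 := m)) (NAll 1 (NIff (R2 P 0 1) (R1 (P m) 1)))"
    by (subst transfer[symmetric]) (use assms(1) in simp_all)
  then show ?thesis using assms(2) by simp
qed

lemma star2_std_right:
  assumes "n > 0" "x \<in> hypernat S"
  shows "star2 S P x (std S n) \<longleftrightarrow> star1 S (\<lambda>m. P m n) x"
  using star2_swap[OF assms(2) std_hypernat[OF assms(1)], of P]
    star2_std_left[OF assms, of "\<lambda>m n. P n m"] by simp

lemma star1_eq: "n > 0 \<Longrightarrow> x \<in> hypernat S \<Longrightarrow> star1 S (\<lambda>m. m = n) x \<longleftrightarrow> x = std S n"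
proof -
  assume n: "n > 0" and x: "x \<in> hypernat S"
  have "hsat S (std S \<circ> (\<lambda>_. 1)(0 := n)) (NAll 1 (NIff (R1 (\<lambda>m. m = n) 1) (NEq 1 0)))"
    by (subst transfer[symmetric]) (use n in simp_all)
  then show ?thesis using x by simp
qed

lemma star1_disj:
  assumes "x \<in> hypernat S"
  shows "star1 S (\<lambda>n. P n \<or> Q n) x \<longleftrightarrow> star1 S P x \<or> star1 S Q x"
proof -
  have "hsat S ((\<lambda>_. std S 1)(0 := x)) (NIff (R1 (\<lambda>n. P n \<or> Q n) 0) (NOr (R1 P 0) (R1 Q 0)))"
    by (rule transfer1[OF _ assms]) simp
  then show ?thesis by simp
qed

lemma star1_False: "\<not> star1 S (\<lambda>_. False) x"
proof
  assume *: "star1 S (\<lambda>_. False) x"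
  have "hsat S ((\<lambda>_. std S 1)(0 := x)) (NNeg (R1 (\<lambda>_. False) 0))"
    by (rule transfer1[OF _ star1_hypernat[OF *]]) simp
  then show False using * by simp
qed

lemma star1_finite:
  assumes "finite A" "star1 S (\<lambda>n. n \<in> A) x"
  shows "\<exists>n\<in>A. n > 0 \<and> x = std S n"
  using assms
proof (induction A)
  case (insert n A)
  have x: "x \<in> hypernat S" using insert.prems star1_hypernat by blast
  have "star1 S (\<lambda>m. m = n \<or> m \<in> A) x" using insert.prems by simp
  then consider "star1 S (\<lambda>m. m = n) x" | "star1 S (\<lambda>m. m \<in> A) x" using star1_disj[OF x] by blast
  then show ?case
  proof cases
    case 1
    \<comment> \<open>\<open>A\<close> may contain 0, which is not a positive integer, so the
      starred predicate cannot hold there.\<close>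
    have "n > 0"
    proof (rule ccontr)
      assume "\<not> n > 0"
      then show False using star1_mono[OF 1, of "\<lambda>_. False"] star1_False by auto
    qed
    then show ?thesis using star1_eq[OF _ x] 1 by blast
  next
    case 2
    then show ?thesis using insert.IH by blast
  qed
qed (simp add: star1_False)

lemma infinite_hypernat_ge:
  assumes z: "z \<in> infinite_hypernat S" and n: "n > 0"
  shows "star1 S (\<lambda>m. n \<le> m) z"
proof (rule ccontr)
  have z': "z \<in> hypernat S" using z by (simp add: infinite_hypernat_def)
  assume "\<not> star1 S (\<lambda>m. n \<le> m) z"
  then have "star1 S (\<lambda>m. m \<in> {..<n}) z"
    using star1_not[OF z', of "\<lambda>m. n \<le> m"] by (simp add: not_le)
  then show False
    using star1_finite[of "{..<n}" z] z by (auto simp: infinite_hypernat_def Npos_def)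
qed

lemma hle_star2: "hle S x y \<longleftrightarrow> star2 S (\<le>) x y"
  by (simp add: hle_def star2_def rel2_def)

lemma infinite_initial_segment:
  assumes z: "z \<in> infinite_hypernat S"
  shows "infinite (initial_segment S z)"
proof
  have z': "z \<in> hypernat S" using z by (simp add: infinite_hypernat_def)
  assume "finite (initial_segment S z)"
  moreover have "std S ` Npos \<subseteq> initial_segment S z"
    using infinite_hypernat_ge[OF z] star2_std_left[OF _ z'] std_hypernat
    by (auto simp: initial_segment_def hle_star2 Npos_def)
  ultimately have "finite (std S ` Npos)" by (rule finite_subset[rotated])
  moreover have "inj_on (std S) Npos" by (auto simp: inj_on_def Npos_def std_eq_iff)
  ultimately have "finite Npos" using finite_imageD by blast
  then show False by (simp add: Npos_def infinite_Ioi)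
qed

lemma finite_initial_segment_std:
  assumes n: "n > 0"
  shows "finite (initial_segment S (std S n))"
proof (rule finite_subset)
  show "initial_segment S (std S n) \<subseteq> std S ` {..n}"
  proof
    fix a assume "a \<in> initial_segment S (std S n)"
    then have "star1 S (\<lambda>m. m \<in> {..n}) a"
      using star2_std_right[OF n] by (auto simp: initial_segment_def hle_star2)
    then show "a \<in> std S ` {..n}" using star1_finite[of "{..n}" a] by blast
  qed
qed simp

lemma internal_initial_segment:
  assumes z: "z \<in> hypernat S"
  shows "\<exists>s. internal_set S s \<and> elts (nonstandard S) s = initial_segment S z"
proof -
  have "initial_segment S z = {y \<in> hypernat S. star2 S (\<lambda>m n. n \<le> m) z y}"
    using star2_swap[OF _ z, of _ "(\<le>)"] by (auto simp: initial_segment_def hle_star2)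
  then show ?thesis using internal_section[OF z] by simp
qed

text \<open>Over the empty language internal presentation asks for an internal nonempty domain, and
  infinite domains are elementarily equivalent; the isomorphism is then a bare bijection.\<close>

lemma eqpoll_initial_segment:
  assumes iso: "isomorphism_property S" and z: "z \<in> infinite_hypernat S" "z' \<in> infinite_hypernat S"
  shows "initial_segment S z \<approx> initial_segment S z'"
proof -
  define M :: "'w \<Rightarrow> 'w fo_structure" where
    "M z = \<lparr>univ = initial_segment S z, funs = undefined, rels = undefined\<rparr>" for z
  have p: "internally_presented S ([], []) (M z)" if "z \<in> infinite_hypernat S" for z
    using internal_initial_segment[of z] infinite_initial_segment[OF that] that
    by (auto simp: internally_presented_def is_structure_def M_def infinite_hypernat_def)
  have "elementarily_equivalent ([], []) (M z) (M z')"
    using infinite_initial_segment z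
    by (intro elementarily_equivalent_infinite_pure_sets) (auto simp: M_def)
  then have "isomorphic ([], []) (M z) (M z')"
    using iso p[OF z(1)] p[OF z(2)] unfolding isomorphism_property_def by blast
  then show ?thesis
    unfolding isomorphic_def M_def eqpoll_def by auto
qed

text \<open>Evaluates the description operator in \<open>pattern_at\<close>: a finite count cannot
  coincide with \<infinity>, since [1, z] is infinite for infinite \<open>z\<close>.\<close>

lemma has_size_unique:
  assumes "has_size S T k" "has_size S T l"
  shows "k = l"
proof -
  obtain z where z: "z \<in> infinite_hypernat S" using infinite_hypernat_nonempty by blast
  have "infinite T" if "has_size S T \<infinity>"
    using that z infinite_initial_segment[OF z] eqpoll_finite_iff[of T] by (auto simp: has_size_def)
  then show ?thesis using assms by (cases k; cases l) (auto simp: has_size_def)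
qed

lemma pattern_at_eqI:
  assumes "has_size S {(p, a). p \<in> starset S primes \<and> a \<in> hypernat S \<and>
    tp S (hpow S p a) \<in> C \<and> exactly_divides S p a x} k"
  shows "pattern_at S x C = k"
  unfolding pattern_at_def using assms has_size_unique by (intro the_equality)

end

section \<open>Components of hypernaturals\<close>

lemma prime_pow_dvd_primepow:
  assumes "prime (p::nat)" "prime q" "a > 0" "p ^ a dvd q ^ b"
  shows "p = q \<and> a \<le> b"
proof -
  have "p dvd p ^ a" using assms(3) by (simp add: dvd_power)
  then have "p dvd q ^ b" using assms(4) by (rule dvd_trans)
  then have "p = q" using assms(1,2) prime_dvd_power primes_dvd_imp_eq by blast
  then show ?thesis using power_dvd_imp_le[of q a b] assms(2,4) prime_gt_1_nat by simp
qed

lemma prime_pow_eq_iff: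
  assumes "prime (p::nat)" "prime q" "a > 0" "b > 0"
  shows "p ^ a = q ^ b \<longleftrightarrow> p = q \<and> a = b"
  using prime_pow_dvd_primepow[OF assms(1,2,3), of b] prime_pow_dvd_primepow[OF assms(2,1,4), of a] by auto

lemma prime_pow_in_components_iff:
  assumes "n > 0" "prime p" "a > 0"
  shows "p ^ a \<in> components n \<longleftrightarrow> (\<exists>m>0. n = p ^ a * m \<and> \<not> p dvd m)"
proof
  assume "p ^ a \<in> components n"
  then obtain q b where *: "prime q" "b > 0" "p ^ a = q ^ b" "\<exists>m>0. n = q ^ b * m \<and> \<not> q dvd m"
    using components_iff[OF assms(1)] by blast
  then have "p = q" "a = b" using prime_pow_eq_iff[OF assms(2) *(1) assms(3) *(2)] by simp_all
  then show "\<exists>m>0. n = p ^ a * m \<and> \<not> p dvd m" using *(4) by simp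
qed (use components_iff[OF assms(1)] assms(2,3) in blast)

lemma components_pos: "y \<in> components n \<Longrightarrow> y > 0"
  by (auto simp: components_def dest!: in_prime_factors_imp_prime prime_gt_0_nat)

lemma components_le: "n > 0 \<Longrightarrow> y \<in> components n \<Longrightarrow> y \<le> n"
  using components_iff[of n y] by auto

lemma components_1 [simp]: "components (Suc 0) = {}"
  by (simp add: components_def)

context hyperextension begin

definition hcomponents :: "'w \<Rightarrow> 'w set" where
  "hcomponents x = {y \<in> hypernat S. star2 S (\<lambda>n y. y \<in> components n) x y}"

lemma starop_unique:
  assumes f: "\<And>m n. m > 0 \<Longrightarrow> n > 0 \<Longrightarrow> f m n > 0" and x: "x \<in> hypernat S" and y: "y \<in> hypernat S"
  shows "\<exists>!z. z \<in> hypernat S \<and> star3 S (\<lambda>m n k. k = f m n) x y z"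
proof -
  have "hsat S ((\<lambda>_. std S 1)(0 := x, 1 := y)) (NEx 2 (R3 (\<lambda>m n k. k = f m n) 0 1 2))"
    by (rule transfer2[OF _ x y]) (simp add: f)
  then have ex: "\<exists>z\<in>hypernat S. star3 S (\<lambda>m n k. k = f m n) x y z" by simp
  have "hsat S ((\<lambda>_. std S 1)(0 := x, 1 := y))
      (NAll 2 (NAll 3 (NImp (NAnd (R3 (\<lambda>m n k. k = f m n) 0 1 2) (R3 (\<lambda>m n k. k = f m n) 0 1 3)) (NEq 2 3))))"
    by (rule transfer2[OF _ x y]) simp
  from ex this[simplified] show ?thesis by blast
qed

lemma starop_star3:
  assumes f: "\<And>m n. m > 0 \<Longrightarrow> n > 0 \<Longrightarrow> f m n > 0" and x: "x \<in> hypernat S" and y: "y \<in> hypernat S"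
  shows starop_hypernat: "starop S f x y \<in> hypernat S"
    and "\<And>z. z \<in> hypernat S \<Longrightarrow> star3 S (\<lambda>m n k. k = f m n) x y z \<longleftrightarrow> z = starop S f x y"
proof -
  have ex1: "\<exists>!z. z \<in> hypernat S \<and> star3 S (\<lambda>m n k. k = f m n) x y z"
    by (rule starop_unique[OF f x y])
  have "rel3 (\<lambda>m n k. k = f m n) = {[m, n, f m n] | m n. m \<in> Npos \<and> n \<in> Npos}"
    using f by (auto simp: rel3_def Npos_def)
  then have "starop S f x y = (THE z. z \<in> hypernat S \<and> star3 S (\<lambda>m n k. k = f m n) x y z)"
    by (simp add: starop_def star3_def)
  then have *: "starop S f x y \<in> hypernat S \<and> star3 S (\<lambda>m n k. k = f m n) x y (starop S f x y)"
    using theI'[OF ex1] by simp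
  then show "starop S f x y \<in> hypernat S" by simp
  show "star3 S (\<lambda>m n k. k = f m n) x y z \<longleftrightarrow> z = starop S f x y" if "z \<in> hypernat S" for z
    using * ex1 that by blast
qed

lemma star1_starop:
  assumes f: "\<And>m n. m > 0 \<Longrightarrow> n > 0 \<Longrightarrow> f m n > 0" and x: "x \<in> hypernat S" and y: "y \<in> hypernat S"
  shows "star1 S P (starop S f x y) \<longleftrightarrow> star2 S (\<lambda>m n. P (f m n)) x y"
proof -
  have "hsat S ((\<lambda>_. std S 1)(0 := x, 1 := y, 2 := starop S f x y))
      (NImp (R3 (\<lambda>m n k. k = f m n) 0 1 2) (NIff (R1 P 2) (R2 (\<lambda>m n. P (f m n)) 0 1)))"
    by (rule transfer3[OF _ x y starop_hypernat[OF f x y]]) simp_all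
  then show ?thesis using starop_star3[OF f x y] by simp
qed

lemma
  assumes "p \<in> hypernat S" "a \<in> hypernat S"
  shows hpow_hypernat: "hpow S p a \<in> hypernat S"
    and star3_hpow: "z \<in> hypernat S \<Longrightarrow> star3 S (\<lambda>m n k. k = m ^ n) p a z \<longleftrightarrow> z = hpow S p a"
  unfolding hpow_def by (rule starop_star3[OF _ assms]; simp)+

text \<open>With the type of a power turned into a relation between base and exponent, saturation
  applies with the base as parameter and the exponent as unknown.\<close>

lemma tp_hpow_iff:
  assumes "p \<in> hypernat S" "a \<in> hypernat S" "A \<subseteq> Npos"
  shows "A \<in> tp S (hpow S p a) \<longleftrightarrow> star2 S (\<lambda>r c. r ^ c \<in> A) p a"
  using star1_starop[of "\<lambda>m n. m ^ n", OF _ assms(1,2), of "\<lambda>n. n \<in> A"] assms(3)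
  by (simp add: tp_def starset_star1 hpow_def)

lemma star3_hmult:
  assumes "x \<in> hypernat S" "y \<in> hypernat S" "z \<in> hypernat S"
  shows "star3 S (\<lambda>m n k. k = m * n) x y z \<longleftrightarrow> z = hmult S x y"
  unfolding hmult_def by (rule starop_star3(2)[OF _ assms(1,2)]) (simp_all add: assms)

lemma primes_Npos: "primes \<subseteq> Npos"
  by (auto simp: primes_def Npos_def prime_gt_0_nat)

lemma starset_primes: "p \<in> starset S primes \<longleftrightarrow> star1 S prime p"
  using starset_star1[OF primes_Npos] by (simp add: primes_def)

lemma hdvd_star2: "hdvd S x y \<longleftrightarrow> star2 S (dvd) x y"
  by (simp add: hdvd_def star2_def rel2_def)

lemma exactly_divides_iff_hcomponents:
  assumes p: "p \<in> starset S primes" and a: "a \<in> hypernat S" and x: "x \<in> hypernat S"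
  shows "exactly_divides S p a x \<longleftrightarrow> hpow S p a \<in> hcomponents x"
proof -
  have p': "p \<in> hypernat S" "star1 S prime p" using p star1_hypernat by (auto simp: starset_primes)
  have h: "hpow S p a \<in> hypernat S" by (rule hpow_hypernat[OF p'(1) a])
  \<comment> \<open>Variable 3 stands for the power, which the formula can reach only through the
    graph of exponentiation.\<close>
  have "hsat S ((\<lambda>_. std S 1)(0 := p, 1 := a, 2 := x)) (NAll 3 (NImp (NAnd (R1 prime 0) (R3 (\<lambda>m n k. k = m ^ n) 0 1 3))
      (NIff (R2 (\<lambda>n y. y \<in> components n) 2 3)
        (NEx 4 (NAnd (R3 (\<lambda>m n k. k = m * n) 3 4 2) (NNeg (R2 (dvd) 0 4)))))))"
    by (rule transfer3[OF _ p'(1) a x]) (simp add: prime_pow_in_components_iff)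
  then have "\<forall>w\<in>hypernat S. w = hpow S p a \<longrightarrow> (star2 S (\<lambda>n y. y \<in> components n) x w \<longleftrightarrow>
      (\<exists>x'\<in>hypernat S. x = hmult S w x' \<and> \<not> hdvd S p x'))"
    using p' a x by (simp add: star3_hpow star3_hmult hdvd_star2)
  then show ?thesis using h by (simp add: exactly_divides_def hcomponents_def)
qed

lemma hcomponents_hpow:
  assumes x: "x \<in> hypernat S" and y: "y \<in> hcomponents x"
  shows "\<exists>p\<in>starset S primes. \<exists>a\<in>hypernat S. y = hpow S p a"
proof -
  have y': "y \<in> hypernat S" "star2 S (\<lambda>n y. y \<in> components n) x y" using y by (auto simp: hcomponents_def)
  have "hsat S ((\<lambda>_. std S 1)(0 := x, 1 := y)) (NImp (R2 (\<lambda>n y. y \<in> components n) 0 1)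
      (NEx 2 (NAnd (R1 prime 2) (NEx 3 (R3 (\<lambda>m n k. k = m ^ n) 2 3 1)))))"
    by (rule transfer2[OF _ x y'(1)]) (use components_iff prime_gt_0_nat in \<open>simp, metis\<close>)
  then obtain p a where "p \<in> hypernat S" "star1 S prime p" "a \<in> hypernat S" "star3 S (\<lambda>m n k. k = m ^ n) p a y"
    using y'(2) by auto
  then show ?thesis using star3_hpow[of p a y] y'(1) starset_primes by auto
qed

text \<open>Unique factorization, in a form where all exponents are positive.\<close>

lemma hpow_inject:
  assumes p: "p \<in> starset S primes" and a: "a \<in> hypernat S" and q: "q \<in> starset S primes" and b: "b \<in> hypernat S"
    and eq: "hpow S p a = hpow S q b"
  shows "p = q \<and> a = b"
proof -
  have pq: "p \<in> hypernat S" "star1 S prime p" "q \<in> hypernat S" "star1 S prime q"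
    using p q star1_hypernat by (auto simp: starset_primes)
  have h: "hpow S p a \<in> hypernat S" by (rule hpow_hypernat[OF pq(1) a])
  have "hsat S ((\<lambda>_. std S 1)(0 := p, 1 := a, 2 := q)) (NAll 3 (NAll 4
      (NImp (NAnd (NAnd (R1 prime 0) (R1 prime 2)) (NAnd (R3 (\<lambda>m n k. k = m ^ n) 0 1 4) (R3 (\<lambda>m n k. k = m ^ n) 2 3 4)))
        (NAnd (NEq 0 2) (NEq 1 3)))))"
    by (rule transfer3[OF _ pq(1) a pq(3)]) (auto simp: prime_pow_eq_iff)
  then have "\<forall>b\<in>hypernat S. \<forall>w\<in>hypernat S. star3 S (\<lambda>m n k. k = m ^ n) p a w \<and> star3 S (\<lambda>m n k. k = m ^ n) q b w
      \<longrightarrow> p = q \<and> a = b"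
    using pq by simp
  then show ?thesis using star3_hpow[OF pq(1) a h] star3_hpow[OF pq(3) b h] b h eq by metis
qed

lemma hcomponents_subset_initial_segment:
  assumes x: "x \<in> hypernat S"
  shows "hcomponents x \<subseteq> initial_segment S x"
proof
  fix y assume y: "y \<in> hcomponents x"
  then have y': "y \<in> hypernat S" by (simp add: hcomponents_def)
  have "hsat S ((\<lambda>_. std S 1)(0 := x, 1 := y)) (NImp (R2 (\<lambda>n y. y \<in> components n) 0 1) (R2 (\<le>) 1 0))"
    by (rule transfer2[OF _ x y']) (simp add: components_le)
  then show "y \<in> initial_segment S x"
    using y by (simp add: hcomponents_def initial_segment_def hle_star2)
qed

text \<open>\<open>Y\<close> is finite externally, so its elements are added one by one, each time
  by transferring \<open>components_subset_ex\<close>. The lower bound on the number of components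
  travels along because a transferred formula cannot refer to the external set
  \<open>Y\<close>.\<close>

lemma ex_hcomponents_eq:
  assumes x: "x \<in> hypernat S" and "finite Y" "Y \<subseteq> hcomponents x"
  shows "\<exists>w\<in>hypernat S. hcomponents w = Y \<and> star1 S (\<lambda>w. card Y \<le> card (components w)) w"
  using assms(2,3)
proof (induction Y)
  case empty
  have 1: "std S 1 \<in> hypernat S" by (rule std_hypernat) simp
  have "hcomponents (std S 1) = {}"
    using star2_std_left[of 1 _ "\<lambda>n y. y \<in> components n"] star1_False by (auto simp: hcomponents_def)
  moreover have "star1 S (\<lambda>w. 0 \<le> card (components w)) (std S 1)"
    using star1_std[of 1 "\<lambda>w. 0 \<le> card (components w)"] by simp
  ultimately show ?case using 1 by auto
next
  case (insert y Y)
  then obtain w where w: "w \<in> hypernat S" "hcomponents w = Y" "star1 S (\<lambda>w. card Y \<le> card (components w)) w" by auto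
  have y: "y \<in> hcomponents x" "y \<in> hypernat S" using insert.prems by (auto simp: hcomponents_def)
  define j where "j = card Y"
  have ex: "\<exists>v>0. Suc j \<le> card (components v) \<and> (\<forall>u>0. u \<in> components v \<longleftrightarrow> u \<in> components n \<or> u = k)"
    if "k \<in> components m" "\<forall>u>0. u \<in> components n \<longrightarrow> u \<in> components m" "k \<notin> components n"
      "j \<le> card (components n)" for m n k
  proof -
    have "insert k (components n) \<subseteq> components m" using that(1,2) components_pos[of _ n] by blast
    then obtain v where v: "v > 0" "components v = insert k (components n)" using components_subset_ex by blast
    then have "card (components v) = Suc (card (components n))" using that(3) finite_components by simp
    then show ?thesis using v that(4) by (intro exI[of _ v]) auto
  qed
  have "hsat S ((\<lambda>_. std S 1)(0 := x, 1 := w, 2 := y))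
      (NImp (NAnd (NAnd (R2 (\<lambda>n y. y \<in> components n) 0 2)
          (NAll 3 (NImp (R2 (\<lambda>n y. y \<in> components n) 1 3) (R2 (\<lambda>n y. y \<in> components n) 0 3))))
        (NAnd (NNeg (R2 (\<lambda>n y. y \<in> components n) 1 2)) (R1 (\<lambda>w. j \<le> card (components w)) 1)))
      (NEx 4 (NAnd (R1 (\<lambda>w. Suc j \<le> card (components w)) 4)
        (NAll 3 (NIff (R2 (\<lambda>n y. y \<in> components n) 4 3) (NOr (R2 (\<lambda>n y. y \<in> components n) 1 3) (NEq 3 2)))))))"
    by (rule transfer3[OF _ x w(1) y(2)]) (simp, use ex in blast)
  moreover have "star2 S (\<lambda>n y. y \<in> components n) x y" "\<not> star2 S (\<lambda>n y. y \<in> components n) w y"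
    "\<forall>u\<in>hypernat S. star2 S (\<lambda>n y. y \<in> components n) w u \<longrightarrow> star2 S (\<lambda>n y. y \<in> components n) x u"
    using y insert.hyps(2) insert.prems unfolding w(2)[symmetric] hcomponents_def by blast+
  ultimately obtain v where v: "v \<in> hypernat S" "star1 S (\<lambda>w. Suc j \<le> card (components w)) v"
    "\<forall>u\<in>hypernat S. star2 S (\<lambda>n y. y \<in> components n) v u \<longleftrightarrow> star2 S (\<lambda>n y. y \<in> components n) w u \<or> u = y"
    using w(3) by (auto simp: j_def)
  have "hcomponents v = insert y (hcomponents w)" using v(3) y(2) unfolding hcomponents_def by blast
  then show ?case using v(1,2) w(2) insert.hyps by (auto simp: j_def)
qed

text \<open>Transfers an enumeration of \<open>components n\<close> by
  \<open>{1..card (components n)}\<close>; the starred number of components of \<open>w\<close>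
  serves as \<open>z\<close>. One component is required at least, since \<open>z\<close> is a
  positive hypernatural.\<close>

lemma initial_segment_lepoll_hcomponents:
  assumes w: "w \<in> hypernat S" "star1 S (\<lambda>w. 1 \<le> card (components w)) w"
  shows "\<exists>z\<in>hypernat S. initial_segment S z \<lesssim> hcomponents w \<and>
    (\<forall>j. star1 S (\<lambda>w. j \<le> card (components w)) w \<longrightarrow> star1 S (\<lambda>z. j \<le> z) z)"
proof -
  define enum where "enum n = (SOME h. bij_betw h {1..card (components n)} (components n))" for n
  have enum: "bij_betw (enum n) {1..card (components n)} (components n)" for n
    using someI_ex[OF ex_bij_betw_nat_finite_1[OF finite_components[of n]]] by (simp add: enum_def)
  have enum_in: "enum n k \<in> components n" if "k > 0" "k \<le> card (components n)" for n k
    using bspec[OF bij_betwE[OF enum[of n]], of k] that by simp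
  have enum_inj: "k = l" if "0 < k" "k \<le> card (components n)" "0 < l" "l \<le> card (components n)" "enum n k = enum n l" for n k l
    using inj_onD[OF bij_betw_imp_inj_on[OF enum[of n]], of k l] that by simp
  \<comment> \<open>The graph of the enumeration, cut off at the number of components, beyond which
    the values of \<open>enum\<close> are arbitrary.\<close>
  define B where "B n k y \<longleftrightarrow> k \<le> card (components n) \<and> y = enum n k" for n k y
  have "hsat S ((\<lambda>_. std S 1)(0 := w)) (NImp (R1 (\<lambda>w. 1 \<le> card (components w)) 0) (NEx 1 (R2 (\<lambda>w z. z = card (components w)) 0 1)))"
    by (rule transfer1[OF _ w(1)]) simp
  then obtain z where z: "z \<in> hypernat S" "star2 S (\<lambda>w z. z = card (components w)) w z" using w(2) by auto
  have 1: "\<forall>k\<in>hypernat S. star2 S (\<le>) k z \<longrightarrow> (\<exists>y\<in>hypernat S. star3 S B w k y \<and> star2 S (\<lambda>n y. y \<in> components n) w y)"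
  proof -
    have "hsat S ((\<lambda>_. std S 1)(0 := w, 1 := z)) (NImp (R2 (\<lambda>w z. z = card (components w)) 0 1)
        (NAll 2 (NImp (R2 (\<le>) 2 1) (NEx 3 (NAnd (R3 B 0 2 3) (R2 (\<lambda>n y. y \<in> components n) 0 3))))))"
      by (rule transfer2[OF _ w(1) z(1)]) (simp add: B_def, use enum_in components_pos in blast)
    then show ?thesis using z(2) by simp
  qed
  have 2: "\<forall>k\<in>hypernat S. \<forall>l\<in>hypernat S. \<forall>y\<in>hypernat S. star3 S B w k y \<and> star3 S B w l y \<longrightarrow> k = l"
  proof -
    have "hsat S ((\<lambda>_. std S 1)(0 := w)) (NAll 1 (NAll 2 (NAll 3 (NImp (NAnd (R3 B 0 1 3) (R3 B 0 2 3)) (NEq 1 2)))))"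
      by (rule transfer1[OF _ w(1)]) (simp add: B_def, use enum_inj in blast)
    then show ?thesis by simp
  qed
  have 3: "star1 S (\<lambda>z. j \<le> z) z" if "star1 S (\<lambda>w. j \<le> card (components w)) w" for j
  proof -
    have "hsat S ((\<lambda>_. std S 1)(0 := w, 1 := z)) (NImp (NAnd (R2 (\<lambda>w z. z = card (components w)) 0 1) (R1 (\<lambda>w. j \<le> card (components w)) 0))
        (R1 (\<lambda>z. j \<le> z) 1))"
      by (rule transfer2[OF _ w(1) z(1)]) simp
    then show ?thesis using z(2) that by simp
  qed
  obtain h where h: "\<forall>k\<in>initial_segment S z. h k \<in> hypernat S \<and> star3 S B w k (h k) \<and> star2 S (\<lambda>n y. y \<in> components n) w (h k)"
    using bchoice[of "initial_segment S z" "\<lambda>k y. y \<in> hypernat S \<and> star3 S B w k y \<and> star2 S (\<lambda>n y. y \<in> components n) w y"] 1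
    unfolding initial_segment_def hle_star2 by auto
  have "inj_on h (initial_segment S z)"
  proof (rule inj_onI)
    fix k l assume *: "k \<in> initial_segment S z" "l \<in> initial_segment S z" "h k = h l"
    then have "k \<in> hypernat S" "l \<in> hypernat S" by (simp_all add: initial_segment_def)
    then show "k = l" using 2 h * by metis
  qed
  moreover have "h ` initial_segment S z \<subseteq> hcomponents w" using h unfolding hcomponents_def by blast
  ultimately show ?thesis using z(1) 3 unfolding lepoll_def by blast
qed

text \<open>With \<open>k\<close> the external count, more than \<open>k\<close> starred components
  would let the enumeration map the standard numbers up to \<open>k + 1\<close> injectively into a
  set of \<open>k\<close> elements. The resulting standard bound is visible to the type of
  \<open>x\<close>.\<close>

lemma card_hcomponents:
  assumes x: "x \<in> hypernat S" and fin: "finite (hcomponents x)"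
  shows "star1 S (\<lambda>n. card (components n) \<le> card (hcomponents x)) x"
proof (rule ccontr)
  define k where "k = card (hcomponents x)"
  assume "\<not> star1 S (\<lambda>n. card (components n) \<le> card (hcomponents x)) x"
  then have gt: "star1 S (\<lambda>n. Suc k \<le> card (components n)) x"
    using star1_not[OF x, of "\<lambda>n. card (components n) \<le> k"] by (simp add: k_def not_le Suc_le_eq)
  then have "star1 S (\<lambda>w. 1 \<le> card (components w)) x" by (rule star1_mono) simp
  from initial_segment_lepoll_hcomponents[OF x this]
  obtain z where z: "z \<in> hypernat S" "initial_segment S z \<lesssim> hcomponents x" "star1 S (\<lambda>z. Suc k \<le> z) z"
    using gt by blast
  have "std S ` {1..Suc k} \<subseteq> initial_segment S z"
  proof
    fix a assume "a \<in> std S ` {1..Suc k}"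
    then obtain n where n: "a = std S n" "n > 0" "n \<le> Suc k" by auto
    have "star1 S (\<lambda>z. n \<le> z) z" using z(3) by (rule star1_mono) (use n(3) in simp)
    then show "a \<in> initial_segment S z"
      using n std_hypernat star2_std_left[OF n(2) z(1)] by (simp add: initial_segment_def hle_star2)
  qed
  moreover obtain h where "inj_on h (initial_segment S z)" "h ` initial_segment S z \<subseteq> hcomponents x"
    using z(2) by (auto simp: lepoll_def)
  ultimately have "inj_on h (std S ` {1..Suc k})" "h ` std S ` {1..Suc k} \<subseteq> hcomponents x"
    by (auto intro: inj_on_subset)
  then have "card (std S ` {1..Suc k}) \<le> k" using card_inj_on_le fin by (metis k_def)
  moreover have "card (std S ` {1..Suc k}) = Suc k"
    using std_eq_iff by (subst card_image) (auto simp: inj_on_def)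
  ultimately show False by simp
qed

end

section \<open>Infinitely many components of one type\<close>

lemma betaN_finite_Inter:
  assumes F: "F \<in> betaN" and "finite \<A>" "\<A> \<subseteq> F"
  shows "\<Inter>\<A> \<inter> Npos \<in> F"
  using assms(2,3)
proof (induction \<A>)
  case empty
  then show ?case by (simp add: betaN_top[OF F])
next
  case (insert A \<A>)
  then show ?case using betaN_Int[OF F, of A "\<Inter>\<A> \<inter> Npos"] by (simp add: Int_assoc)
qed

context saturated_hyperextension begin

text \<open>
  By saturation there is a \<open>w\<close> with infinitely many components, all of them components of \<open>x\<close> of
  type \<open>Q\<close>; they are enumerated by an initial segment.
\<close>

lemma initial_segment_lepoll_components_of_type:
  assumes x: "x \<in> hypernat S" and Q: "Q \<in> betaN"
    and inf: "\<And>A. A \<in> Q \<Longrightarrow> infinite {y \<in> hcomponents x. y \<in> starset S A}"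
  shows "\<exists>z\<in>infinite_hypernat S. initial_segment S z \<lesssim> {y \<in> hcomponents x. tp S y = Q}"
proof -
  \<comment> \<open>A condition pairs a set of the type \<open>Q\<close> with a size; all together
    ask for more than any standard number of components, each of type exactly
    \<open>Q\<close>.\<close>
  define R where "R = (\<lambda>(A, k::nat) n w. components w \<subseteq> components n \<inter> A \<and> k \<le> card (components w))"
  have "\<exists>w\<in>hypernat S. \<forall>r\<in>R ` (Q \<times> UNIV). star2 S r x w"
  proof (rule saturation[OF x])
    fix \<D> assume D: "finite \<D>" "\<D> \<subseteq> R ` (Q \<times> UNIV)"
    obtain \<D>' where D': "\<D>' \<subseteq> Q \<times> UNIV" "finite \<D>'" "\<D> = R ` \<D>'"
      using finite_subset_image[OF D] by blast
    \<comment> \<open>Finitely many conditions reduce to one: the intersection of the sets and an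
      upper bound of the sizes.\<close>
    define A0 where "A0 = \<Inter>(fst ` \<D>') \<inter> Npos"
    have "fst ` \<D>' \<subseteq> Q" using D'(1) by auto
    then have A0: "A0 \<in> Q" using betaN_finite_Inter[OF Q finite_imageI[OF D'(2)]] by (simp add: A0_def)
    obtain k0 where k0: "\<And>k. k \<in> snd ` \<D>' \<Longrightarrow> k \<le> k0"
      using finite_imageI[OF D'(2), of snd] unfolding finite_nat_set_iff_bounded_le by blast
    obtain Y where Y: "Y \<subseteq> {y \<in> hcomponents x. y \<in> starset S A0}" "finite Y" "card Y = k0"
      using infinite_arbitrarily_large[OF inf[OF A0], of k0] by blast
    then have "Y \<subseteq> hcomponents x" by blast
    from ex_hcomponents_eq[OF x Y(2) this]
    obtain w where w: "w \<in> hypernat S" "hcomponents w = Y" "star1 S (\<lambda>w. k0 \<le> card (components w)) w"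
      unfolding Y(3) by blast
    have "star2 S (R (A, k)) x w" if Ak: "(A, k) \<in> \<D>'" for A k
    proof -
      have A: "A \<subseteq> Npos" using Ak D'(1) betaN_subset[OF Q, of A] by blast
      have A0A: "A0 \<subseteq> A" using Ak unfolding A0_def by force
      have k: "star1 S (\<lambda>w. k \<le> card (components w)) w"
        using w(3) by (rule star1_mono) (use k0[of k] Ak in force)
      have "star1 S (\<lambda>n. n \<in> A) y" if y: "y \<in> Y" for y
      proof -
        have "y \<in> starset S A0" using y Y(1) by blast
        then have "star1 S (\<lambda>n. n \<in> A0) y" using starset_star1[of A0 y] A0_def by blast
        then show ?thesis by (rule star1_mono) (use A0A in blast)
      qed
      moreover have "star2 S (\<lambda>n y. y \<in> components n) x y" if "y \<in> Y" for y
        using that Y(1) unfolding hcomponents_def by blast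
      moreover have "hsat S ((\<lambda>_. std S 1)(0 := x, 1 := w))
          (NImp (NAnd (R1 (\<lambda>w. k \<le> card (components w)) 1)
            (NAll 2 (NImp (R2 (\<lambda>n y. y \<in> components n) 1 2) (NAnd (R2 (\<lambda>n y. y \<in> components n) 0 2) (R1 (\<lambda>n. n \<in> A) 2)))))
          (R2 (R (A, k)) 0 1))"
        by (rule transfer2[OF _ x w(1)]) (simp add: R_def subset_eq, use components_pos in blast)
      ultimately show ?thesis using k w(2) unfolding hcomponents_def by auto
    qed
    then have "\<forall>r\<in>\<D>. star2 S r x w" unfolding D'(3) by auto
    then show "\<exists>w\<in>hypernat S. \<forall>r\<in>\<D>. star2 S r x w" using w(1) by blast
  qed
  then obtain w where w: "w \<in> hypernat S" and "\<forall>r\<in>R ` (Q \<times> UNIV). star2 S r x w" by blast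
  then have wR: "star2 S (R (A, k)) x w" if "A \<in> Q" for A k using that by blast
  have k: "star1 S (\<lambda>w. k \<le> card (components w)) w" for k
  proof -
    have "hsat S ((\<lambda>_. std S 1)(0 := x, 1 := w)) (NImp (R2 (R (Npos, k)) 0 1) (R1 (\<lambda>w. k \<le> card (components w)) 1))"
      by (rule transfer2[OF _ x w]) (simp add: R_def)
    then show ?thesis using wR[OF betaN_top[OF Q], of k] by simp
  qed
  obtain z where z: "z \<in> hypernat S" "initial_segment S z \<lesssim> hcomponents w" "\<And>j. star1 S (\<lambda>z. j \<le> z) z"
    using initial_segment_lepoll_hcomponents[OF w k] k by blast
  \<comment> \<open>\<open>z\<close> lies above every standard number.\<close>
  have "z \<noteq> std S n" if "n > 0" for n
    using z(3)[of "Suc n"] star1_std[OF that, of "\<lambda>z. Suc n \<le> z"] by auto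
  then have "z \<in> infinite_hypernat S" using z(1) by (auto simp: infinite_hypernat_def Npos_def)
  moreover have "hcomponents w \<subseteq> {y \<in> hcomponents x. tp S y = Q}"
  proof
    fix y assume y: "y \<in> hcomponents w"
    then have y': "y \<in> hypernat S" "star2 S (\<lambda>n y. y \<in> components n) w y" by (simp_all add: hcomponents_def)
    have *: "star2 S (\<lambda>n y. y \<in> components n) x y \<and> star1 S (\<lambda>n. n \<in> A) y" if A: "A \<in> Q" for A
    proof -
      have "hsat S ((\<lambda>_. std S 1)(0 := x, 1 := w, 2 := y)) (NImp (NAnd (R2 (R (A, 0)) 0 1) (R2 (\<lambda>n y. y \<in> components n) 1 2))
          (NAnd (R2 (\<lambda>n y. y \<in> components n) 0 2) (R1 (\<lambda>n. n \<in> A) 2)))"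
        by (rule transfer3[OF _ x w y'(1)]) (simp add: R_def subset_eq)
      then show ?thesis using wR[OF A, of 0] y'(2) by simp
    qed
    have "Q \<subseteq> tp S y"
    proof
      fix A assume A: "A \<in> Q"
      have "A \<subseteq> Npos" by (rule betaN_subset[OF Q A])
      then show "A \<in> tp S y" using *[OF A] starset_star1[of A y] by (simp add: tp_def)
    qed
    then have "Q = tp S y" by (rule betaN_eqI[OF Q tp_betaN[OF y'(1)]])
    moreover have "star2 S (\<lambda>n y. y \<in> components n) x y" using *[OF betaN_top[OF Q]] by blast
    ultimately show "y \<in> {y \<in> hcomponents x. tp S y = Q}" using y'(1) by (simp add: hcomponents_def)
  qed
  ultimately show ?thesis using z(2) lepoll_trans subset_imp_lepoll by blast
qed

text \<open>A compactness argument: finitely many sets, each holding finitely many components of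
  \<open>x\<close>, cannot cover all of them. By saturation some component avoids all such sets at
  once, and then its type contains none of them.\<close>

lemma ex_accumulation_component:
  assumes x: "x \<in> hypernat S" and inf: "infinite (hcomponents x)"
  shows "\<exists>y\<in>hcomponents x. \<forall>A\<in>tp S y. infinite {u \<in> hcomponents x. u \<in> starset S A}"
proof -
  define \<A> where "\<A> = {A. A \<subseteq> Npos \<and> finite {u \<in> hcomponents x. u \<in> starset S A}}"
  define R where "R A n y \<longleftrightarrow> y \<in> components n \<and> y \<notin> A" for A n y
  have R_iff: "star2 S (R A) x y \<longleftrightarrow> y \<in> hcomponents x \<and> y \<notin> starset S A" if A: "A \<in> \<A>" and y: "y \<in> hypernat S" for A y
  proof -
    have "hsat S ((\<lambda>_. std S 1)(0 := x, 1 := y))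
        (NIff (R2 (R A) 0 1) (NAnd (R2 (\<lambda>n y. y \<in> components n) 0 1) (NNeg (R1 (\<lambda>n. n \<in> A) 1))))"
      by (rule transfer2[OF _ x y]) (simp add: R_def)
    moreover have "A \<subseteq> Npos" using A by (simp add: \<A>_def)
    ultimately show ?thesis using y starset_star1[of A y] by (simp add: hcomponents_def)
  qed
  have "\<exists>y\<in>hypernat S. \<forall>r\<in>R ` \<A>. star2 S r x y"
  proof (rule saturation[OF x])
    fix \<D> assume D: "finite \<D>" "\<D> \<subseteq> R ` \<A>"
    obtain \<D>' where D': "\<D>' \<subseteq> \<A>" "finite \<D>'" "\<D> = R ` \<D>'"
      using finite_subset_image[OF D] by blast
    have "finite (\<Union>A\<in>\<D>'. {u \<in> hcomponents x. u \<in> starset S A})"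
      using D'(1,2) by (auto simp: \<A>_def)
    then obtain y where y: "y \<in> hcomponents x" "y \<notin> (\<Union>A\<in>\<D>'. {u \<in> hcomponents x. u \<in> starset S A})"
      using inf by (meson finite_subset subsetI)
    then have "y \<in> hypernat S" by (simp add: hcomponents_def)
    then have "\<forall>r\<in>\<D>. star2 S r x y" unfolding D'(3) using R_iff D'(1) y by blast
    then show "\<exists>y\<in>hypernat S. \<forall>r\<in>\<D>. star2 S r x y" using \<open>y \<in> hypernat S\<close> by blast
  qed
  then obtain y where y: "y \<in> hypernat S" "\<And>A. A \<in> \<A> \<Longrightarrow> y \<in> hcomponents x \<and> y \<notin> starset S A"
    using R_iff by blast
  \<comment> \<open>The empty set is among the avoided sets, so at least one condition is present to
    make \<open>y\<close> a component.\<close>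
  have "starset S {} = {}"
    using star1_False by (auto simp: starset_star1)
  then have "{} \<in> \<A>" by (simp add: \<A>_def)
  then have "y \<in> hcomponents x" using y(2) by blast
  moreover have "infinite {u \<in> hcomponents x. u \<in> starset S A}" if "A \<in> tp S y" for A
    using y(2)[of A] that by (auto simp: tp_def \<A>_def)
  ultimately show ?thesis by blast
qed

end

section \<open>Exponents of basic classes\<close>

lemma uf_equiv_iff: "uf_equiv F G \<longleftrightarrow> (\<forall>A\<in>upsets. A \<in> F \<longleftrightarrow> A \<in> G)"
  by (auto simp: uf_equiv_def uf_dvd_def)

lemma upsets_Npos: "A \<in> upsets \<Longrightarrow> A \<subseteq> Npos"
  by (simp add: upsets_def)

lemma antichain_prime_powers_fixed_exponent: "n > 0 \<Longrightarrow> antichain {r ^ n | r. prime r}"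
  unfolding antichain_def using prime_pow_dvd_primepow by blast

text \<open>The powers of a prime enter an upward closed \<open>A\<close> at one exponent and stay
  there. Index 0 collects the last powers outside \<open>A\<close>, index 1 the first ones
  inside.\<close>

definition entry :: "nat set \<Rightarrow> nat \<Rightarrow> nat set" where
  "entry A i = {r ^ (c + i) | r c. prime r \<and> c > 0 \<and> r ^ c \<notin> A \<and> r ^ Suc c \<in> A}"

text \<open>Each prime crosses into \<open>A\<close> at most once, and nontrivial powers of distinct
  primes do not divide each other.\<close>

lemma antichain_entry:
  assumes A: "A \<in> upsets"
  shows "antichain (entry A i)"
  unfolding antichain_def
proof (intro ballI impI)
  fix m n assume "m \<in> entry A i" "n \<in> entry A i" and dvd: "m dvd n"
  then obtain r c s d where r: "m = r ^ (c + i)" "prime r" "c > 0" "r ^ c \<notin> A" "r ^ Suc c \<in> A"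
    and s: "n = s ^ (d + i)" "prime s" "d > 0" "s ^ d \<notin> A" "s ^ Suc d \<in> A"
    unfolding entry_def by blast
  have rs: "r = s" "c \<le> d"
    using prime_pow_dvd_primepow[OF r(2) s(2), of "c + i" "d + i"] dvd r(1,3) s(1) by simp_all
  have "c = d"
  proof (rule ccontr)
    assume "c \<noteq> d"
    then have "r ^ Suc c dvd r ^ d" using rs(2) by (intro le_imp_power_dvd) simp
    then have "r ^ d \<in> A" using upsets_dvd[OF A r(5)] prime_gt_0_nat[OF r(2)] by simp
    then show False using s(4) rs(1) by simp
  qed
  then show "m = n" using r(1) s(1) rs(1) by simp
qed

lemma entry_Npos: "entry A i \<subseteq> Npos"
  by (auto simp: entry_def Npos_def prime_gt_0_nat)

context hyperextension begin

text \<open>An antichain in the type of \<open>x\<close> makes its class a singleton, which forces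
  \<open>G\<close> to be that type.\<close>

lemma antichain_tp_uf_equiv:
  assumes "x \<in> hypernat S" "G \<in> betaN" "uf_equiv G (tp S x)" "M \<in> tp S x" "antichain M"
  shows "M \<in> G"
  using uf_equiv_antichain[OF tp_betaN[OF assms(1)] assms(2) uf_equiv_sym[OF assms(3)] assms(4,5)] assms(4) by simp

text \<open>
  If \<open>b\<close> and \<open>b + 1\<close> were separated by an upward closed set \<open>A\<close>, then one of the antichains
  \<open>entry A 0\<close> and \<open>entry A 1\<close> would contain the power whose exponent lies in the class.
\<close>

lemma exponents_closed_succ:
  assumes G: "G \<in> betaN" "\<And>M. M \<in> G \<Longrightarrow> \<not> antichain M"
    and q: "q \<in> starset S primes" and b: "b \<in> hypernat S" "b' \<in> hypernat S"
    and succ: "star2 S (\<lambda>m k. k = m + 1) b b'"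
  shows "uf_equiv G (tp S (hpow S q b)) \<longleftrightarrow> uf_equiv G (tp S (hpow S q b'))"
proof (rule ccontr)
  assume neq: "\<not> ?thesis"
  have q': "q \<in> hypernat S" "star1 S prime q" using q star1_hypernat by (auto simp: starset_primes)
  have "\<not> uf_equiv (tp S (hpow S q b)) (tp S (hpow S q b'))"
  proof
    assume "uf_equiv (tp S (hpow S q b)) (tp S (hpow S q b'))"
    then show False using neq uf_equiv_trans uf_equiv_sym by blast
  qed
  then obtain A where A: "A \<in> upsets" "A \<in> tp S (hpow S q b) \<longleftrightarrow> A \<notin> tp S (hpow S q b')"
    unfolding uf_equiv_iff by blast
  have AN: "A \<subseteq> Npos" by (rule upsets_Npos[OF A(1)])
  have A': "star2 S (\<lambda>r c. r ^ c \<in> A) q b \<longleftrightarrow> \<not> star2 S (\<lambda>r c. r ^ c \<in> A) q b'"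
    using A(2) tp_hpow_iff[OF q'(1) b(1) AN] tp_hpow_iff[OF q'(1) b(2) AN] by simp
  \<comment> \<open>Since \<open>A\<close> is upward closed, the smaller of the two powers must be
    the one outside.\<close>
  have "hsat S ((\<lambda>_. std S 1)(0 := q, 1 := b, 2 := b')) (NImp (NAnd (R2 (\<lambda>m k. k = m + 1) 1 2) (R2 (\<lambda>r c. r ^ c \<in> A) 0 1))
      (R2 (\<lambda>r c. r ^ c \<in> A) 0 2))"
  proof (rule transfer3[OF _ q'(1) b])
    fix m n k :: nat assume mnk: "m > 0" "n > 0" "k > 0"
    have "m ^ Suc n \<in> A" if "m ^ n \<in> A" using upsets_dvd[OF A(1) that, of "m ^ Suc n"] mnk by simp
    then show "nsat ((\<lambda>_. 1)(0 := m, 1 := n, 2 := k)) (NImp (NAnd (R2 (\<lambda>m k. k = m + 1) 1 2) (R2 (\<lambda>r c. r ^ c \<in> A) 0 1))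
      (R2 (\<lambda>r c. r ^ c \<in> A) 0 2))" by auto
  qed
  then have Ab: "\<not> star2 S (\<lambda>r c. r ^ c \<in> A) q b" "star2 S (\<lambda>r c. r ^ c \<in> A) q b'"
    using A' succ by auto
  have "hsat S ((\<lambda>_. std S 1)(0 := q, 1 := b, 2 := b'))
      (NImp (NAnd (NAnd (R1 prime 0) (R2 (\<lambda>m k. k = m + 1) 1 2)) (NAnd (NNeg (R2 (\<lambda>r c. r ^ c \<in> A) 0 1)) (R2 (\<lambda>r c. r ^ c \<in> A) 0 2)))
        (NAnd (R2 (\<lambda>r c. r ^ c \<in> entry A 0) 0 1) (R2 (\<lambda>r c. r ^ c \<in> entry A 1) 0 2)))"
  proof (rule transfer3[OF _ q'(1) b])
    fix m n k :: nat assume mnk: "m > 0" "n > 0" "k > 0"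
    have "m ^ (n + i) \<in> entry A i" if "prime m" "m ^ n \<notin> A" "m ^ Suc n \<in> A" for i
      unfolding entry_def using that mnk by blast
    from this[of 0] this[of 1]
    show "nsat ((\<lambda>_. 1)(0 := m, 1 := n, 2 := k))
      (NImp (NAnd (NAnd (R1 prime 0) (R2 (\<lambda>m k. k = m + 1) 1 2)) (NAnd (NNeg (R2 (\<lambda>r c. r ^ c \<in> A) 0 1)) (R2 (\<lambda>r c. r ^ c \<in> A) 0 2)))
        (NAnd (R2 (\<lambda>r c. r ^ c \<in> entry A 0) 0 1) (R2 (\<lambda>r c. r ^ c \<in> entry A 1) 0 2)))"
      by auto
  qed
  then have "entry A 0 \<in> tp S (hpow S q b)" "entry A 1 \<in> tp S (hpow S q b')"
    using Ab succ q' b by (simp_all add: tp_hpow_iff entry_Npos)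
  \<comment> \<open>\<open>G\<close> is equivalent to one of the two types, and both hold an
    antichain, which would pass to \<open>G\<close>.\<close>
  then show False
    using neq G antichain_entry[OF A(1)] hpow_hypernat[OF q'(1)] b antichain_tp_uf_equiv by metis
qed

text \<open>\<open>n\<close> is a standard number, so ordinary induction iterates
  \<open>exponents_closed_succ\<close>; galaxies arise from shifts of this kind.\<close>

lemma exponents_closed_add:
  assumes G: "G \<in> betaN" "\<And>M. M \<in> G \<Longrightarrow> \<not> antichain M"
    and q: "q \<in> starset S primes"
  shows "b \<in> hypernat S \<Longrightarrow> b' \<in> hypernat S \<Longrightarrow> star2 S (\<lambda>m k. k = m + n) b b' \<Longrightarrow>
    uf_equiv G (tp S (hpow S q b)) \<longleftrightarrow> uf_equiv G (tp S (hpow S q b'))"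
proof (induction n arbitrary: b')
  case 0
  have "hsat S ((\<lambda>_. std S 1)(0 := b, 1 := b')) (NImp (R2 (\<lambda>m k. k = m + 0) 0 1) (NEq 0 1))"
    by (rule transfer2[OF _ 0(1,2)]) simp
  then have "b = b'" using 0(3) by simp
  then show ?case by simp
next
  case (Suc n)
  have "hsat S ((\<lambda>_. std S 1)(0 := b, 1 := b')) (NImp (R2 (\<lambda>m k. k = m + Suc n) 0 1)
      (NEx 2 (NAnd (R2 (\<lambda>m k. k = m + n) 0 2) (R2 (\<lambda>m k. k = m + 1) 2 1))))"
    by (rule transfer2[OF _ Suc.prems(1,2)]) simp
  then obtain c where c: "c \<in> hypernat S" "star2 S (\<lambda>m k. k = m + n) b c" "star2 S (\<lambda>m k. k = m + 1) c b'"
    using Suc.prems(3) by auto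
  show ?case
    using Suc.IH[OF Suc.prems(1) c(1,2)] exponents_closed_succ[OF G q c(1) Suc.prems(2) c(3)] by simp
qed

text \<open>For a standard exponent \<open>n\<close>, the \<open>n\<close>-th powers of primes form
  an antichain in the type of the power. Thus only galaxies of infinite exponents can occur.\<close>

lemma exponents_infinite:
  assumes G: "G \<in> betaN" "\<And>M. M \<in> G \<Longrightarrow> \<not> antichain M"
    and q: "q \<in> starset S primes" and b: "b \<in> hypernat S" "uf_equiv G (tp S (hpow S q b))"
  shows "b \<in> infinite_hypernat S"
proof (rule ccontr)
  have q': "q \<in> hypernat S" "star1 S prime q" using q star1_hypernat by (auto simp: starset_primes)
  assume "b \<notin> infinite_hypernat S"
  then obtain n where n: "n > 0" "b = std S n" using b(1) by (auto simp: infinite_hypernat_def Npos_def)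
  define M where "M = {r ^ n | r. prime (r::nat)}"
  have MN: "M \<subseteq> Npos" by (auto simp: M_def Npos_def prime_gt_0_nat)
  have "star1 S (\<lambda>r. r ^ n \<in> M) q" using q'(2) by (rule star1_mono) (auto simp: M_def)
  then have "star2 S (\<lambda>r c. r ^ c \<in> M) q b"
    using star2_std_right[OF n(1) q'(1), of "\<lambda>r c. r ^ c \<in> M"] n(2) by simp
  then have "M \<in> tp S (hpow S q b)" using tp_hpow_iff[OF q'(1) b(1) MN] by simp
  moreover have "antichain M" unfolding M_def by (rule antichain_prime_powers_fixed_exponent[OF n(1)])
  ultimately show False
    using antichain_tp_uf_equiv[OF hpow_hypernat[OF q'(1) b(1)] G(1) b(2)] G(2) by blast
qed

text \<open>Once a power of \<open>q\<close> lies in an upward closed set, so do all higher ones;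
  membership at \<open>c\<close> is squeezed between its equal values at \<open>b\<close> and
  \<open>d\<close>.\<close>

lemma exponents_convex:
  assumes q: "q \<in> starset S primes" and bcd: "b \<in> hypernat S" "c \<in> hypernat S" "d \<in> hypernat S"
    and le: "hle S b c" "hle S c d"
    and eq: "uf_equiv G (tp S (hpow S q b))" "uf_equiv G (tp S (hpow S q d))"
  shows "uf_equiv G (tp S (hpow S q c))"
  unfolding uf_equiv_iff
proof
  fix A assume A: "A \<in> upsets"
  have AN: "A \<subseteq> Npos" by (rule upsets_Npos[OF A])
  have q': "q \<in> hypernat S" "star1 S prime q" using q star1_hypernat by (auto simp: starset_primes)
  have mono: "star2 S (\<lambda>r c. r ^ c \<in> A) q v"
    if uv: "u \<in> hypernat S" "v \<in> hypernat S" and "hle S u v" "star2 S (\<lambda>r c. r ^ c \<in> A) q u" for u v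
  proof -
    have "hsat S ((\<lambda>_. std S 1)(0 := q, 1 := u, 2 := v)) (NImp (NAnd (R2 (\<le>) 1 2) (R2 (\<lambda>r c. r ^ c \<in> A) 0 1))
        (R2 (\<lambda>r c. r ^ c \<in> A) 0 2))"
    proof (rule transfer3[OF _ q'(1) uv])
      fix m n k :: nat assume mnk: "m > 0" "n > 0" "k > 0"
      have "m ^ k \<in> A" if "m ^ n \<in> A" "n \<le> k"
        using upsets_dvd[OF A that(1) le_imp_power_dvd[OF that(2)]] mnk by simp
      then show "nsat ((\<lambda>_. 1)(0 := m, 1 := n, 2 := k)) (NImp (NAnd (R2 (\<le>) 1 2) (R2 (\<lambda>r c. r ^ c \<in> A) 0 1))
        (R2 (\<lambda>r c. r ^ c \<in> A) 0 2))" by auto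
    qed
    then show ?thesis using that(3,4) by (simp add: hle_star2)
  qed
  have "A \<in> G \<longleftrightarrow> star2 S (\<lambda>r c. r ^ c \<in> A) q b" "A \<in> G \<longleftrightarrow> star2 S (\<lambda>r c. r ^ c \<in> A) q d"
    using uf_equiv_upsets[OF eq(1) A] uf_equiv_upsets[OF eq(2) A]
      tp_hpow_iff[OF q'(1) bcd(1) AN] tp_hpow_iff[OF q'(1) bcd(3) AN] by simp_all
  then show "A \<in> G \<longleftrightarrow> A \<in> tp S (hpow S q c)"
    using mono[OF bcd(1,2) le(1)] mono[OF bcd(2,3) le(2)] tp_hpow_iff[OF q'(1) bcd(2) AN] by blast
qed

text \<open>With the standard \<open>n\<close> built into the relation, addition takes the binary
  form used in \<open>exponents_closed_add\<close>.\<close>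

lemma star2_hadd_std:
  assumes b: "b \<in> hypernat S" and n: "n > 0"
  shows "hadd S b (std S n) \<in> hypernat S" "star2 S (\<lambda>m k. k = m + n) b (hadd S b (std S n))"
proof -
  have n': "std S n \<in> hypernat S" by (rule std_hypernat[OF n])
  show c: "hadd S b (std S n) \<in> hypernat S"
    unfolding hadd_def by (rule starop_hypernat[OF _ b n']) simp
  have c3: "star3 S (\<lambda>m n k. k = m + n) b (std S n) (hadd S b (std S n))"
    using starop_star3(2)[of "\<lambda>m n. m + n", OF _ b n' c] by (simp add: hadd_def)
  have "hsat S (std S \<circ> (\<lambda>_. 1)(0 := n)) (NAll 1 (NAll 2 (NImp (R3 (\<lambda>m n k. k = m + n) 1 0 2) (R2 (\<lambda>m k. k = m + n) 1 2))))"
    by (subst transfer[symmetric]) (use n in simp_all)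
  then show "star2 S (\<lambda>m k. k = m + n) b (hadd S b (std S n))" using b c c3 by simp
qed

text \<open>Shifts by standard numbers in both directions stay among these exponents, hence whole
  galaxies are absorbed; convexity makes them consecutive.\<close>

lemma exponents_union_of_galaxies:
  assumes G: "G \<in> betaN" "\<And>M. M \<in> G \<Longrightarrow> \<not> antichain M"
    and q: "q \<in> starset S primes" and ne: "\<exists>b\<in>hypernat S. uf_equiv G (tp S (hpow S q b))"
  shows "union_of_consecutive_galaxies S {b \<in> hypernat S. uf_equiv G (tp S (hpow S q b))}"
proof -
  define U where "U = {b \<in> hypernat S. uf_equiv G (tp S (hpow S q b))}"
  have gal: "galaxy S b \<subseteq> U" if b: "b \<in> U" for b
  proof
    fix c assume c: "c \<in> galaxy S b"
    have b': "b \<in> hypernat S" "uf_equiv G (tp S (hpow S q b))" using b by (simp_all add: U_def)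
    have c': "c \<in> hypernat S" using c by (simp add: galaxy_def)
    consider "c = b" | n where "n > 0" "c = hadd S b (std S n)" | n where "n > 0" "b = hadd S c (std S n)"
      using c by (auto simp: galaxy_def Npos_def)
    then have "uf_equiv G (tp S (hpow S q c))"
    proof cases
      case 1
      then show ?thesis using b' by simp
    next
      case 2
      then have "star2 S (\<lambda>m k. k = m + n) b c" using star2_hadd_std(2)[OF b'(1) 2(1)] by simp
      then show ?thesis using exponents_closed_add[OF G q b'(1) c', of n] b'(2) by simp
    next
      case 3
      then have "star2 S (\<lambda>m k. k = m + n) c b" using star2_hadd_std(2)[OF c' 3(1)] by simp
      then show ?thesis using exponents_closed_add[OF G q c' b'(1), of n] b'(2) by simp
    qed
    then show "c \<in> U" using c' by (simp add: U_def)
  qed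
  have self: "b \<in> galaxy S b" if "b \<in> U" for b using that by (simp add: galaxy_def U_def)
  have "U \<noteq> {}" using ne by (auto simp: U_def)
  then have g1: "galaxy S ` U \<noteq> {}" by simp
  have "U \<subseteq> infinite_hypernat S"
    using exponents_infinite[OF G q] unfolding U_def by blast
  then have g2: "galaxy S ` U \<subseteq> galaxy S ` infinite_hypernat S" by (rule image_mono)
  have g3: "U = \<Union>(galaxy S ` U)" using gal self by blast
  have g4: "\<forall>a\<in>U. \<forall>b\<in>U. \<forall>c\<in>hypernat S. hle S a c \<and> hle S c b \<longrightarrow> galaxy S c \<in> galaxy S ` U"
  proof (intro ballI impI)
    fix a b c assume *: "a \<in> U" "b \<in> U" "c \<in> hypernat S" "hle S a c \<and> hle S c b"
    then have "uf_equiv G (tp S (hpow S q c))"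
      using exponents_convex[OF q, of a c b G] by (simp add: U_def)
    then show "galaxy S c \<in> galaxy S ` U" using *(3) by (auto simp: U_def)
  qed
  show ?thesis
    unfolding union_of_consecutive_galaxies_def U_def[symmetric]
    by (intro exI[of _ "galaxy S ` U"] conjI g1 g2 g3 g4)
qed

section \<open>Basic classes, and patterns as counts of components\<close>

lemma generators_primes:
  assumes "P \<in> prime_ultrafilters" "p \<in> generators S P"
  shows "p \<in> starset S primes"
  using assms unfolding prime_ultrafilters_def generators_def tp_def by blast

text \<open>Equivalence depends on types only, so it does not matter which pair of \<open>u\<close>
  witnesses that a type belongs to the basic class.\<close>

lemma primepow_class:
  assumes p: "p \<in> starset S primes" and a: "a \<in> hypernat S"
  defines "u \<equiv> power_equiv S (tp S p) `` {(p, a)}"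
  shows "tp S p \<in> prime_ultrafilters" "u \<in> exponent_classes S (tp S p)"
    "tp S (hpow S p a) \<in> basic_class S u"
    "\<And>q b. q \<in> generators S (tp S p) \<Longrightarrow> b \<in> hypernat S \<Longrightarrow>
      tp S (hpow S q b) \<in> basic_class S u \<longleftrightarrow> uf_equiv (tp S (hpow S p a)) (tp S (hpow S q b))"
proof -
  have p': "p \<in> hypernat S" using p star1_hypernat by (simp add: starset_primes)
  then have pg: "p \<in> generators S (tp S p)" by (simp add: generators_def)
  show "tp S p \<in> prime_ultrafilters"
    using p tp_betaN[OF p'] primes_Npos by (simp add: prime_ultrafilters_def tp_def)
  show "u \<in> exponent_classes S (tp S p)"
    unfolding exponent_classes_def u_def using pg a by (intro quotientI) simp
  have u: "(q, b) \<in> u \<longleftrightarrow> q \<in> generators S (tp S p) \<and> b \<in> hypernat S \<and> uf_equiv (tp S (hpow S p a)) (tp S (hpow S q b))" for q b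
    using pg a by (simp add: u_def power_equiv_def)
  have refl: "uf_equiv F F" for F by (simp add: uf_equiv_iff)
  show "tp S (hpow S p a) \<in> basic_class S u" unfolding basic_class_def using u pg a refl by blast
  show "tp S (hpow S q b) \<in> basic_class S u \<longleftrightarrow> uf_equiv (tp S (hpow S p a)) (tp S (hpow S q b))"
    if "q \<in> generators S (tp S p)" "b \<in> hypernat S" for q b
  proof
    assume "tp S (hpow S q b) \<in> basic_class S u"
    then obtain q' b' where "(q', b') \<in> u" "tp S (hpow S q b) = tp S (hpow S q' b')"
      unfolding basic_class_def by blast
    then show "uf_equiv (tp S (hpow S p a)) (tp S (hpow S q b))" using u by simp
  next
    assume "uf_equiv (tp S (hpow S p a)) (tp S (hpow S q b))"
    then show "tp S (hpow S q b) \<in> basic_class S u" unfolding basic_class_def using u that by blast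
  qed
qed

text \<open>By \<open>hpow_inject\<close> the pattern may count components of \<open>x\<close>
  instead of pairs of prime and exponent.\<close>

lemma pattern_set_bij_betw:
  assumes x: "x \<in> hypernat S"
  shows "bij_betw (\<lambda>(p, a). hpow S p a)
    {(p, a). p \<in> starset S primes \<and> a \<in> hypernat S \<and> tp S (hpow S p a) \<in> C \<and> exactly_divides S p a x}
    {y \<in> hcomponents x. tp S y \<in> C}"
  unfolding bij_betw_def
proof (intro conjI inj_onI set_eqI iffI)
  fix v w assume "v \<in> {(p, a). p \<in> starset S primes \<and> a \<in> hypernat S \<and> tp S (hpow S p a) \<in> C \<and> exactly_divides S p a x}"
    "w \<in> {(p, a). p \<in> starset S primes \<and> a \<in> hypernat S \<and> tp S (hpow S p a) \<in> C \<and> exactly_divides S p a x}"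
    "(case v of (p, a) \<Rightarrow> hpow S p a) = (case w of (p, a) \<Rightarrow> hpow S p a)"
  then show "v = w" using hpow_inject by (cases v; cases w) (simp, blast)
next
  fix y assume "y \<in> (\<lambda>(p, a). hpow S p a) ` {(p, a). p \<in> starset S primes \<and> a \<in> hypernat S \<and> tp S (hpow S p a) \<in> C \<and> exactly_divides S p a x}"
  then obtain p a where *: "y = hpow S p a" "p \<in> starset S primes" "a \<in> hypernat S" "tp S (hpow S p a) \<in> C" "exactly_divides S p a x"
    by auto
  then have "y \<in> hcomponents x" using exactly_divides_iff_hcomponents[OF *(2,3) x] by simp
  then show "y \<in> {y \<in> hcomponents x. tp S y \<in> C}" using *(1,4) by simp
next
  fix y assume y: "y \<in> {y \<in> hcomponents x. tp S y \<in> C}"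
  then obtain p a where *: "p \<in> starset S primes" "a \<in> hypernat S" "y = hpow S p a"
    using hcomponents_hpow[OF x, of y] by blast
  then have "exactly_divides S p a x" using exactly_divides_iff_hcomponents[OF *(1,2) x] y by simp
  then show "y \<in> (\<lambda>(p, a). hpow S p a) ` {(p, a). p \<in> starset S primes \<and> a \<in> hypernat S \<and> tp S (hpow S p a) \<in> C \<and> exactly_divides S p a x}"
    using * y by (intro image_eqI[of _ _ "(p, a)"]) simp_all
qed

end

section \<open>The two alternatives\<close>

context saturated_hyperextension begin

text \<open>The second kind concerns every generator \<open>q\<close>, and a union of galaxies is
  nonempty, so \<open>q\<close> needs an exponent in the class. That some power of the base falls
  into a given set is a property of the base, shared by \<open>p\<close> and \<open>q\<close> since
  their types agree; saturation meets all sets of the type with one exponent.\<close>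

lemma ex_exponent_of_type:
  assumes p: "p \<in> hypernat S" and a: "a \<in> hypernat S" and q: "q \<in> generators S (tp S p)"
  shows "\<exists>b\<in>hypernat S. tp S (hpow S q b) = tp S (hpow S p a)"
proof -
  define G where "G = tp S (hpow S p a)"
  have G: "G \<in> betaN" unfolding G_def by (rule tp_betaN[OF hpow_hypernat[OF p a]])
  have q': "q \<in> hypernat S" "tp S q = tp S p" using q by (simp_all add: generators_def)
  define R where "R A r b \<longleftrightarrow> r ^ b \<in> A" for A and r b :: nat
  have "\<exists>b\<in>hypernat S. \<forall>r\<in>R ` G. star2 S r q b"
  proof (rule saturation[OF q'(1)])
    fix \<D> assume D: "finite \<D>" "\<D> \<subseteq> R ` G"
    obtain \<D>' where D': "\<D>' \<subseteq> G" "finite \<D>'" "\<D> = R ` \<D>'"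
      using finite_subset_image[OF D] by blast
    define A0 where "A0 = \<Inter>\<D>' \<inter> Npos"
    have A0: "A0 \<in> G" unfolding A0_def by (rule betaN_finite_Inter[OF G D'(2,1)])
    have "star2 S (R A0) p a"
      using A0 tp_hpow_iff[OF p a betaN_subset[OF G A0]] unfolding G_def R_def by simp
    have ex: "star1 S (\<lambda>r. \<exists>b>0. R A0 r b) u \<longleftrightarrow> (\<exists>b\<in>hypernat S. star2 S (R A0) u b)" if "u \<in> hypernat S" for u
    proof -
      have "hsat S ((\<lambda>_. std S 1)(0 := u)) (NIff (R1 (\<lambda>r. \<exists>b>0. R A0 r b) 0) (NEx 1 (R2 (R A0) 0 1)))"
        by (rule transfer1[OF _ that]) simp
      then show ?thesis by simp
    qed
    then have "star1 S (\<lambda>r. \<exists>b>0. R A0 r b) p" using p a \<open>star2 S (R A0) p a\<close> by blast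
    then have "{r \<in> Npos. \<exists>b>0. R A0 r b} \<in> tp S p" by (simp add: tp_def star1_def)
    then have "{r \<in> Npos. \<exists>b>0. R A0 r b} \<in> tp S q" by (simp only: q'(2))
    then have "star1 S (\<lambda>r. \<exists>b>0. R A0 r b) q" by (simp add: tp_def star1_def)
    then obtain b where b: "b \<in> hypernat S" "star2 S (R A0) q b" using ex[OF q'(1)] by blast
    have "star2 S (R A) q b" if "A \<in> \<D>'" for A
      using b(2) q'(1) b(1) by (rule star2_mono) (use that in \<open>auto simp: R_def A0_def\<close>)
    then show "\<exists>b\<in>hypernat S. \<forall>r\<in>\<D>. star2 S r q b" using b(1) unfolding D'(3) by blast
  qed
  then obtain b where b: "b \<in> hypernat S" "\<And>A. A \<in> G \<Longrightarrow> star2 S (R A) q b" by blast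
  have "A \<in> tp S (hpow S q b)" if A: "A \<in> G" for A
    using b(2)[OF A] tp_hpow_iff[OF q'(1) b(1) betaN_subset[OF G A]] unfolding R_def by simp
  then have "G = tp S (hpow S q b)"
    by (intro betaN_eqI[OF G tp_betaN[OF hpow_hypernat[OF q'(1) b(1)]]] subsetI)
  then show ?thesis using b(1) unfolding G_def by auto
qed

lemma second_kind_class:
  assumes x: "x \<in> hypernat S" and fin: "finite (hcomponents x)" and y: "y \<in> hcomponents x"
    and anti: "\<And>M. M \<in> tp S y \<Longrightarrow> \<not> antichain M"
  shows "\<exists>C\<in>basic_classes S. second_kind S C \<and> pattern_at S x C > 0"
proof -
  obtain p a where p: "p \<in> starset S primes" and a: "a \<in> hypernat S" and y_eq: "y = hpow S p a"
    using hcomponents_hpow[OF x y] by blast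
  have p': "p \<in> hypernat S" using p star1_hypernat by (simp add: starset_primes)
  define u where "u = power_equiv S (tp S p) `` {(p, a)}"
  define C where "C = basic_class S u"
  note cl = primepow_class[OF p a, folded u_def, folded C_def]
  have G: "tp S (hpow S p a) \<in> betaN" by (rule tp_betaN[OF hpow_hypernat[OF p' a]])
  have "union_of_consecutive_galaxies S {b \<in> hypernat S. tp S (hpow S q b) \<in> C}"
    if q: "q \<in> generators S (tp S p)" for q
  proof -
    obtain b where b: "b \<in> hypernat S" "tp S (hpow S q b) = tp S (hpow S p a)"
      using ex_exponent_of_type[OF p' a q] by blast
    then have "uf_equiv (tp S (hpow S p a)) (tp S (hpow S q b))" by (simp add: uf_equiv_iff)
    then have ne: "\<exists>b\<in>hypernat S. uf_equiv (tp S (hpow S p a)) (tp S (hpow S q b))" using b(1) by blast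
    have "{b \<in> hypernat S. tp S (hpow S q b) \<in> C} = {b \<in> hypernat S. uf_equiv (tp S (hpow S p a)) (tp S (hpow S q b))}"
      using cl(4)[OF q] by blast
    then show ?thesis
      using exponents_union_of_galaxies[OF G _ generators_primes[OF cl(1) q] ne] anti by (simp add: y_eq)
  qed
  then have "second_kind S C" unfolding second_kind_def using cl(1,2) C_def by blast
  define T where "T = {(p, a). p \<in> starset S primes \<and> a \<in> hypernat S \<and> tp S (hpow S p a) \<in> C \<and> exactly_divides S p a x}"
  \<comment> \<open>With finitely many components the pattern is a finite cardinality, positive
    because of \<open>(p, a)\<close>.\<close>
  have "finite T" using bij_betw_finite[OF pattern_set_bij_betw[OF x, of C]] fin by (simp add: T_def)
  have "pattern_at S x C = enat (card T)"
    by (rule pattern_at_eqI) (use \<open>finite T\<close> in \<open>simp add: has_size_def T_def\<close>)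
  moreover have "(p, a) \<in> T"
    using p a cl(3) exactly_divides_iff_hcomponents[OF p a x] y by (simp add: T_def y_eq)
  then have "card T > 0" using \<open>finite T\<close> by (auto simp: card_gt_0_iff)
  ultimately have "pattern_at S x C > 0" by (simp add: zero_enat_def)
  moreover have "C \<in> basic_classes S" unfolding basic_classes_def using cl(1,2) C_def by blast
  ultimately show ?thesis using \<open>second_kind S C\<close> by blast
qed

text \<open>The count is squeezed: from below by [1, z] for an infinite \<open>z\<close>, injected
  into the components of the type of \<open>y\<close>; from above by [1, x], as components do not
  exceed \<open>x\<close>. The isomorphism property equates both sizes.\<close>

lemma infinite_pattern:
  assumes iso: "isomorphism_property S" and x: "x \<in> hypernat S" and inf: "infinite (hcomponents x)"
  shows "\<exists>C\<in>basic_classes S. pattern_at S x C = \<infinity>"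
proof -
  obtain y where y: "y \<in> hcomponents x" and acc: "\<forall>A\<in>tp S y. infinite {u \<in> hcomponents x. u \<in> starset S A}"
    using ex_accumulation_component[OF x inf] by blast
  have y': "y \<in> hypernat S" using y by (simp add: hcomponents_def)
  obtain z where z: "z \<in> infinite_hypernat S" "initial_segment S z \<lesssim> {u \<in> hcomponents x. tp S u = tp S y}"
    using initial_segment_lepoll_components_of_type[OF x tp_betaN[OF y']] acc by blast
  obtain p a where p: "p \<in> starset S primes" and a: "a \<in> hypernat S" and y_eq: "y = hpow S p a"
    using hcomponents_hpow[OF x y] by blast
  define u where "u = power_equiv S (tp S p) `` {(p, a)}"
  define C where "C = basic_class S u"
  note cl = primepow_class[OF p a, folded u_def, folded C_def]
  define T where "T = {(p, a). p \<in> starset S primes \<and> a \<in> hypernat S \<and> tp S (hpow S p a) \<in> C \<and> exactly_divides S p a x}"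
  have T: "T \<approx> {u \<in> hcomponents x. tp S u \<in> C}"
    using pattern_set_bij_betw[OF x, of C] unfolding T_def eqpoll_def by blast
  have "{u \<in> hcomponents x. tp S u = tp S y} \<subseteq> {u \<in> hcomponents x. tp S u \<in> C}"
    using cl(3) by (auto simp: y_eq)
  then have zT: "initial_segment S z \<lesssim> T"
    using lepoll_trans[OF z(2) subset_imp_lepoll] lepoll_trans2[OF _ eqpoll_sym[OF T]] by blast
  \<comment> \<open>The upper bound [1, x] has size \<infinity> only for infinite \<open>x\<close>;
    a standard \<open>x\<close> could not have infinitely many components.\<close>
  have xI: "x \<in> infinite_hypernat S"
  proof (rule ccontr)
    assume "x \<notin> infinite_hypernat S"
    then obtain n where "n > 0" "x = std S n" using x by (auto simp: infinite_hypernat_def Npos_def)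
    then have "finite (initial_segment S x)" using finite_initial_segment_std by simp
    then show False using inf finite_subset[OF hcomponents_subset_initial_segment[OF x]] by blast
  qed
  have "{u \<in> hcomponents x. tp S u \<in> C} \<subseteq> initial_segment S x"
    using hcomponents_subset_initial_segment[OF x] by blast
  then have Tx: "T \<lesssim> initial_segment S x"
    using lepoll_trans1[OF T subset_imp_lepoll] by blast
  have "T \<approx> initial_segment S z'" if z': "z' \<in> infinite_hypernat S" for z'
  proof (rule lepoll_antisym)
    show "T \<lesssim> initial_segment S z'"
      by (rule lepoll_trans2[OF Tx eqpoll_initial_segment[OF iso xI z']])
    show "initial_segment S z' \<lesssim> T"
      by (rule lepoll_trans1[OF eqpoll_initial_segment[OF iso z' z(1)] zT])
  qed
  then have "pattern_at S x C = \<infinity>"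
    by (intro pattern_at_eqI) (simp add: has_size_def T_def)
  moreover have "C \<in> basic_classes S" unfolding basic_classes_def using cl(1,2) C_def by blast
  ultimately show ?thesis by blast
qed

lemma tp_antichain_if_components_antichain:
  assumes x: "x \<in> hypernat S" and fin: "finite (hcomponents x)"
    and anti: "\<And>y. y \<in> hcomponents x \<Longrightarrow> \<exists>M\<in>tp S y. antichain M"
  shows "\<exists>A\<in>tp S x. antichain A"
proof -
  obtain f where f: "\<And>y. y \<in> hcomponents x \<Longrightarrow> f y \<in> tp S y \<and> antichain (f y)"
    using bchoice[of "hcomponents x" "\<lambda>y M. M \<in> tp S y \<and> antichain M"] anti by blast
  define \<M> where "\<M> = f ` hcomponents x"
  define k where "k = card (hcomponents x)"
  have MN: "\<Union>\<M> \<subseteq> Npos" using f unfolding \<M>_def tp_def by blast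
  have mem: "star1 S (\<lambda>n. n \<in> \<Union>\<M>) y" if y: "y \<in> hcomponents x" for y
  proof -
    have "f y \<subseteq> Npos" "y \<in> starset S (f y)" using f[OF y] by (simp_all add: tp_def)
    then have "star1 S (\<lambda>n. n \<in> f y) y" using starset_star1 by blast
    then show ?thesis by (rule star1_mono) (use y in \<open>auto simp: \<M>_def\<close>)
  qed
  \<comment> \<open>The quantifier over components is absorbed into a unary predicate of
    \<open>x\<close>, which can then be read as a set in the type of \<open>x\<close>.\<close>
  have "hsat S ((\<lambda>_. std S 1)(0 := x)) (NImp (NAll 1 (NImp (R2 (\<lambda>n y. y \<in> components n) 0 1) (R1 (\<lambda>n. n \<in> \<Union>\<M>) 1)))
      (R1 (\<lambda>n. components n \<subseteq> \<Union>\<M>) 0))"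
    by (rule transfer1[OF _ x]) (simp only: nsat.simps fun_upd_same fun_upd_other, use components_pos in auto)
  then have "star1 S (\<lambda>n. components n \<subseteq> \<Union>\<M>) x" using mem by (simp add: hcomponents_def)
  then have "star1 S (\<lambda>n. card (components n) \<le> k \<and> components n \<subseteq> \<Union>\<M>) x"
    using star1_conj[OF x] card_hcomponents[OF x fin] unfolding k_def by simp
  then have "{n \<in> Npos. card (components n) \<le> k \<and> components n \<subseteq> \<Union>\<M>} \<in> tp S x"
    by (simp add: star1_def tp_def)
  moreover have "finite \<M>" using fin by (simp add: \<M>_def)
  moreover have "antichain M" if "M \<in> \<M>" for M using that f unfolding \<M>_def by blast
  ultimately show ?thesis using antichain_of_components[OF tp_betaN[OF x]] by blast
qed

end

theorem theorem5p3:
  fixes S :: "('v, 'w) extension" and F :: "nat set set"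
  assumes "nonstandard_extension S"
    and "c_plus_saturated S"
    and "isomorphism_property S"
    and "F \<in> betaN"
    and "\<not> is_singleton (uf_class F)"
  shows "(\<exists>C\<in>basic_classes S. pattern S F C = \<infinity>) \<or>
         (\<exists>C\<in>basic_classes S. second_kind S C \<and> pattern S F C > 0)"
proof -
  interpret saturated_hyperextension S
    by unfold_locales (fact assms)+
  \<comment> \<open>The very generator chosen in \<open>pattern\<close>, so that
    \<open>pattern S F\<close> unfolds to \<open>pattern_at S x\<close>.\<close>
  define x where "x = (SOME x. x \<in> generators S F)"
  have "x \<in> generators S F"
    using someI_ex[OF generator_exists[OF assms(4)]] by (simp add: x_def)
  then have x: "x \<in> hypernat S" "tp S x = F" by (simp_all add: generators_def)
  have pat: "pattern S F C = pattern_at S x C" for C by (simp add: pattern_def x_def)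
  have "\<not> antichain A" if "A \<in> F" for A
  proof
    assume "antichain A"
    then have "uf_class F \<subseteq> {F}"
      using uf_equiv_antichain[OF assms(4) _ _ that] unfolding uf_class_def by blast
    moreover have "F \<in> uf_class F" using assms(4) by (simp add: uf_class_def uf_equiv_iff)
    ultimately have "uf_class F = {F}" by blast
    then show False using assms(5) by (simp add: is_singleton_def)
  qed
  then have "infinite (hcomponents x) \<or> (\<exists>y\<in>hcomponents x. \<forall>M\<in>tp S y. \<not> antichain M)"
    using tp_antichain_if_components_antichain[OF x(1)] x(2) by blast
  then show ?thesis
    unfolding pat using infinite_pattern[OF assms(3) x(1)] second_kind_class[OF x(1)] by blast
qed

end
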